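(* Let $H$ be a real Hilbert space and let $A$ be a strictly positive invertible bounded operator on $H\oplus H$. Then there exist a real Hilbert space $K$, a positive invertible operator $P$ on $K$, and a symplectic transformation $L\colon H\oplus H \to K\oplus K$ such that $$A = L^{T} \begin{bmatrix} P & 0 \\ 0 & P \end{bmatrix} L.$$ The decomposition is unique in the following sense: if $M$ is any strictly positive invertible operator on a real Hilbert space $\tilde{H}$ and $\tilde{L}\colon H\oplus H \to \tilde{H}\oplus\tilde{H}$ is a symplectic transformation such that $$A = \tilde{L}^{T} \begin{bmatrix} M & 0 \\ 0 & M \end{bmatrix} \tilde{L},$$ then $P$ and $M$ are orthogonally equivalent, i.e. there is an orthogonal transformation $W\colon K\to\tilde{H}$ with $WPW^{T} = M$.
   Context: All operators are bounded and real-linear. For a bounded operator $A\colon H_1\to H_2$ between real Hilbert spaces, the transpose $A^{T}\colon H_2\to H_1$ is the unique bounded operator with $\langle Ax, y\rangle = \langle x, A^{T}y\rangle$ for all $x\in H_1$, $y\in H_2$. An operator $A$ is positive if $A^{T}=A$ and $\langle x, Ax\rangle \ge 0$ for all $x$, and strictly positive if moreover $\langle x, Ax\rangle>0$ for all $x\ne 0$. Invertible means having a bounded inverse. An orthogonal transformation is an operator $W$ with $W^{T}W = I$ and $WW^{T} = I$. For a real Hilbert space $H$, the involution operator $J$ on $H\oplus H$ is $J = \begin{bmatrix} 0 & -I \\ I & 0\end{bmatrix}$, i.e. $J(x,y)=(-y,x)$. For real Hilbert spaces $H$ and $K$, a bounded invertible linear operator $Q\colon H\oplus H\to K\oplus K$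 is a symplectic transformation if $Q^{T}JQ = J$, where $J$ on the left side is the involution operator on $K\oplus K$ and $J$ on the right side is the involution operator on $H\oplus H$. *)

theory Defs
  imports "HOL-Analysis.Analysis"
begin

text \<open>
  HOL cannot quantify existentially over types, so a real Hilbert space is represented by a
  carrier set: a linear subspace, complete in norm, of some real inner product type.
  The direct sum of \<open>H\<close> and \<open>K\<close> is \<open>H \<times> K\<close>, whose inner product (library instance for
  products) is the sum of the componentwise ones.
\<close>

definition real_hilbert_space :: "'a::real_inner set \<Rightarrow> bool" where
  "real_hilbert_space H \<longleftrightarrow> subspace H \<and> complete H"

lemma real_hilbert_space_UNIV:
  "real_hilbert_space (UNIV :: 'a::{real_inner, complete_space} set)"
  by (simp add: real_hilbert_space_def complete_UNIV)

text \<open>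
  Operators are extensional functions (\<open>undefined\<close> outside the carrier), so that equality of
  functions is equality of operators.
\<close>

definition bounded_op :: "'a::real_inner set \<Rightarrow> 'b::real_inner set \<Rightarrow> ('a \<Rightarrow> 'b) \<Rightarrow> bool" where
  "bounded_op H K f \<longleftrightarrow>
     f \<in> H \<rightarrow>\<^sub>E K \<and>
     (\<forall>x\<in>H. \<forall>y\<in>H. f (x + y) = f x + f y) \<and>
     (\<forall>c. \<forall>x\<in>H. f (c *\<^sub>R x) = c *\<^sub>R f x) \<and>
     (\<exists>C. \<forall>x\<in>H. norm (f x) \<le> C * norm x)"

lemma bounded_op_UNIV: "bounded_op UNIV UNIV f \<longleftrightarrow> bounded_linear f"
  by (auto simp: bounded_op_def bounded_linear_def bounded_linear_axioms_def linear_iff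
      mult.commute)

definition id_op :: "'a set \<Rightarrow> 'a \<Rightarrow> 'a" where
  "id_op H = (\<lambda>x\<in>H. x)"

definition invertible_op :: "'a::real_inner set \<Rightarrow> 'b::real_inner set \<Rightarrow> ('a \<Rightarrow> 'b) \<Rightarrow> bool" where
  "invertible_op H K A \<longleftrightarrow>
     bounded_op H K A \<and>
     (\<exists>B. bounded_op K H B \<and> compose H B A = id_op H \<and> compose K A B = id_op K)"

definition transpose_op ::
    "'a::real_inner set \<Rightarrow> 'b::real_inner set \<Rightarrow> ('a \<Rightarrow> 'b) \<Rightarrow> ('b \<Rightarrow> 'a)" where
  "transpose_op H K A =
     (THE B. bounded_op K H B \<and> (\<forall>x\<in>H. \<forall>y\<in>K. A x \<bullet> y = x \<bullet> B y))"

lemma transpose_op_eqI: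
  assumes "subspace H" "bounded_op K H B" "\<And>x y. x \<in> H \<Longrightarrow> y \<in> K \<Longrightarrow> A x \<bullet> y = x \<bullet> B y"
  shows "transpose_op H K A = B"
  unfolding transpose_op_def
proof (rule the_equality)
  fix C
  assume C: "bounded_op K H C \<and> (\<forall>x\<in>H. \<forall>y\<in>K. A x \<bullet> y = x \<bullet> C y)"
  have ext: "C \<in> K \<rightarrow>\<^sub>E H" "B \<in> K \<rightarrow>\<^sub>E H"
    using C assms(2) by (auto simp: bounded_op_def)
  show "C = B"
  proof (rule PiE_ext[OF ext])
    fix y assume y: "y \<in> K"
    then have "C y - B y \<in> H"
      using ext assms(1) by (auto intro: subspace_diff)
    then have "(C y - B y) \<bullet> (C y - B y) = 0"
      using C assms(3) y by (metis inner_diff_right cancel_comm_monoid_add_class.diff_cancel)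
    then show "C y = B y" by simp
  qed
qed (use assms in auto)

definition positive_op :: "'a::real_inner set \<Rightarrow> ('a \<Rightarrow> 'a) \<Rightarrow> bool" where
  "positive_op H A \<longleftrightarrow>
     bounded_op H H A \<and> transpose_op H H A = A \<and> (\<forall>x\<in>H. 0 \<le> x \<bullet> A x)"

definition strictly_positive_op :: "'a::real_inner set \<Rightarrow> ('a \<Rightarrow> 'a) \<Rightarrow> bool" where
  "strictly_positive_op H A \<longleftrightarrow>
     positive_op H A \<and> (\<forall>x\<in>H. x \<noteq> 0 \<longrightarrow> 0 < x \<bullet> A x)"

definition orthogonal_transformation_op ::
    "'a::real_inner set \<Rightarrow> 'b::real_inner set \<Rightarrow> ('a \<Rightarrow> 'b) \<Rightarrow> bool" where
  "orthogonal_transformation_op H K W \<longleftrightarrow>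
     bounded_op H K W \<and>
     compose H (transpose_op H K W) W = id_op H \<and>
     compose K W (transpose_op H K W) = id_op K"

definition involution_op :: "'a::real_inner set \<Rightarrow> 'a \<times> 'a \<Rightarrow> 'a \<times> 'a" where
  "involution_op H = (\<lambda>(x, y)\<in>H \<times> H. (- y, x))"

definition symplectic_op ::
    "'a::real_inner set \<Rightarrow> 'b::real_inner set \<Rightarrow> ('a \<times> 'a \<Rightarrow> 'b \<times> 'b) \<Rightarrow> bool" where
  "symplectic_op H K Q \<longleftrightarrow>
     invertible_op (H \<times> H) (K \<times> K) Q \<and>
     compose (H \<times> H) (transpose_op (H \<times> H) (K \<times> K) Q)
       (compose (H \<times> H) (involution_op K) Q) = involution_op H"

definition diag_op :: "'a::real_inner set \<Rightarrow> ('a \<Rightarrow> 'a) \<Rightarrow> 'a \<times> 'a \<Rightarrow> 'a \<times> 'a" where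
  "diag_op K P = (\<lambda>(x, y)\<in>K \<times> K. (P x, P y))"

definition williamson_factorization ::
    "'a::real_inner set \<Rightarrow> ('a \<times> 'a \<Rightarrow> 'a \<times> 'a) \<Rightarrow>
     'b::real_inner set \<Rightarrow> ('b \<Rightarrow> 'b) \<Rightarrow> ('a \<times> 'a \<Rightarrow> 'b \<times> 'b) \<Rightarrow> bool" where
  "williamson_factorization H A K P L \<longleftrightarrow>
     symplectic_op H K L \<and>
     A = compose (H \<times> H) (transpose_op (H \<times> H) (K \<times> K) L) (compose (H \<times> H) (diag_op K P) L)"

definition orthogonally_equivalent ::
    "'a::real_inner set \<Rightarrow> ('a \<Rightarrow> 'a) \<Rightarrow> 'b::real_inner set \<Rightarrow> ('b \<Rightarrow> 'b) \<Rightarrow> bool" where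
  "orthogonally_equivalent K P H' M \<longleftrightarrow>
     (\<exists>W. orthogonal_transformation_op K H' W \<and>
       compose H' W (compose H' P (transpose_op K H' W)) = M)"

end

theory Submission
  imports Defs
begin

text \<open>
  Existence. Let \<open>q\<close> be the positive square root of \<open>A\<close>. The operator \<open>B = q J q\<close> is
  skew-symmetric and invertible, and its polar decomposition \<open>B = U R\<close> provides a complex structure
  \<open>U\<close> (skew-symmetric, \<open>U\<^sup>2 = - I\<close>) commuting with the positive operator \<open>R\<close>
  (\<open>skew_polar_decomposition\<close>). A positive operator that is complex-linear for \<open>U\<close> leaves some real
  form invariant: a closed subspace \<open>K\<close> with \<open>R K \<subseteq> K\<close> and orthogonal complement \<open>U K\<close>
  (\<open>invariant_real_form_exists\<close>). It is built from cyclic subspaces of \<open>R\<close>: each of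
  them is orthogonal to its image under \<open>U\<close>, and Zorn's lemma adds them up. In the coordinates
  \<open>(x, y) \<mapsto> x + U y\<close> on \<open>K \<oplus> K\<close>,
  \<open>U\<close> is the involution and \<open>R\<close> is \<open>P \<oplus> P\<close> with \<open>P\<close> the restriction of \<open>R\<close> to \<open>K\<close>. The
  symplectic transformation is \<open>R\<^sup>-\<^sup>1\<^sup>/\<^sup>2 q\<close> read in these coordinates.

  Uniqueness. If \<open>L\<close> and \<open>L'\<close> belong to two factorizations, \<open>S = L' L\<inverse>\<close> is symplectic and carries
  \<open>M \<oplus> M\<close> to \<open>P \<oplus> P\<close> by congruence. Such an \<open>S\<close> is rigid: it intertwines \<open>P \<oplus> P\<close> with
  \<open>M \<oplus> M\<close>, commutes with \<open>J\<close>, and is orthogonal (\<open>symplectic_congruence_is_orthogonal\<close>, through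
  uniqueness for a Sylvester equation). So the complexifications of \<open>P\<close> and \<open>M\<close> are unitarily
  equivalent by \<open>S = X + i Y\<close>. A real orthogonal equivalence is assembled from the polar part of
  \<open>X\<close> off \<open>ker X\<close> and from \<open>Y\<close> on \<open>ker X\<close>
  (\<open>unitary_equivalence_imp_orthogonal_equivalence\<close>).

  Both halves rest on projections, adjoints and square roots for complete subspaces of a possibly
  incomplete inner product space. Operators on such a carrier are extended by zero on the
  orthogonal complement, so that operator identities become identities between functions
  on a whole type.
\<close>

section \<open>Projections, Riesz representation and adjoints\<close>

text \<open>
  The orthogonal projection onto a carrier \<open>H\<close>.  The defining property determines the
  value whenever \<open>H\<close> is a Hilbert space, even if the ambient type is not complete.
\<close>

definition hproj :: "'a::real_inner set \<Rightarrow> 'a \<Rightarrow> 'a" where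
  "hproj H x = (SOME p. p \<in> H \<and> (\<forall>h\<in>H. (x - p) \<bullet> h = 0))"

lemma linear_coefficient_zero:
  fixes b c :: real
  assumes "\<And>t. 0 \<le> t * t * c - 2 * t * b"
  shows "b = 0"
proof (rule ccontr)
  assume "b \<noteq> 0"
  \<comment> \<open>The parabola \<open>t\<^sup>2 (1 + |c|) - 2 t b\<close> has its negative minimum here.\<close>
  define t where "t = b / (1 + \<bar>c\<bar>)"
  have pos: "1 + \<bar>c\<bar> > 0" by simp
  have "t * t * c - 2 * t * b \<le> t * t * (1 + \<bar>c\<bar>) - 2 * t * b"
    by (smt (verit) mult_left_mono zero_le_square)
  also have "\<dots> = t * (t * (1 + \<bar>c\<bar>)) - 2 * t * b" by simp
  also have "\<dots> = - (b * b) / (1 + \<bar>c\<bar>)" using pos by (simp add: t_def)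
  also have "\<dots> < 0"
    using pos \<open>b \<noteq> 0\<close> by (metis divide_neg_pos neg_less_0_iff_less not_real_square_gt_zero)
  finally show False using assms[of t] by linarith
qed

text \<open>
  A minimizing sequence for the distance from \<open>x\<close> to \<open>H\<close> is Cauchy by the parallelogram law, hence
  converges inside the complete set \<open>H\<close>.  At the minimizer \<open>p\<close>, moving along any \<open>h \<in> H\<close> cannot
  decrease the distance, so the first-order term \<open>(x - p) \<bullet> h\<close> vanishes.
\<close>

lemma orthogonal_projection_exists:
  assumes "real_hilbert_space H"
  shows "\<exists>p. p \<in> H \<and> (\<forall>h\<in>H. (x - p) \<bullet> h = 0)"
proof -
  have sub: "subspace H" and com: "complete H"
    using assms by (auto simp: real_hilbert_space_def)
  define d where "d = Inf ((\<lambda>h. (norm (x - h))\<^sup>2) ` H)"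
  have bdd: "bdd_below ((\<lambda>h. (norm (x - h))\<^sup>2) ` H)" by (rule bdd_belowI[of _ 0]) auto
  have ne: "H \<noteq> {}" using subspace_0[OF sub] by blast
  have d_le: "d \<le> (norm (x - h))\<^sup>2" if "h \<in> H" for h
    unfolding d_def using that bdd by (intro cInf_lower) auto
  have "\<exists>h\<in>H. (norm (x - h))\<^sup>2 < d + 1 / real (Suc n)" for n
  proof -
    have "Inf ((\<lambda>h. (norm (x - h))\<^sup>2) ` H) < d + 1 / real (Suc n)" by (simp add: d_def)
    then show ?thesis using cInf_lessD[of "(\<lambda>h. (norm (x - h))\<^sup>2) ` H"] ne by blast
  qed
  then obtain s where s: "\<And>n. s n \<in> H" "\<And>n. (norm (x - s n))\<^sup>2 < d + 1 / real (Suc n)"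
    by metis
  have est: "(norm (s m - s n))\<^sup>2 \<le> 2 / real (Suc m) + 2 / real (Suc n)" for m n
  proof -
    \<comment> \<open>Parallelogram law: the midpoint lies in \<open>H\<close>, so it is no closer to \<open>x\<close> than \<open>d\<close> allows.\<close>
    let ?c = "(1/2) *\<^sub>R (s m + s n)"
    have "?c \<in> H" using s sub by (intro subspace_scale subspace_add) auto
    then have "d \<le> (norm (x - ?c))\<^sup>2" by (rule d_le)
    moreover have "(norm (s m - s n))\<^sup>2 =
        2 * (norm (x - s m))\<^sup>2 + 2 * (norm (x - s n))\<^sup>2 - 4 * (norm (x - ?c))\<^sup>2"
      by (simp add: power2_norm_eq_inner inner_diff inner_add inner_commute algebra_simps)
    ultimately show ?thesis using s(2)[of m] s(2)[of n] by linarith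
  qed
  have "Cauchy s"
  proof (rule CauchyI)
    fix e :: real assume "0 < e"
    obtain N where N: "4 / e\<^sup>2 < real N" using reals_Archimedean2 by blast
    have "norm (s m - s n) < e" if "m \<ge> N" "n \<ge> N" for m n
    proof -
      have pos: "0 < e\<^sup>2" using \<open>0 < e\<close> by simp
      have "2 / real (Suc k) < e\<^sup>2 / 2" if "k \<ge> N" for k
      proof -
        have "4 / e\<^sup>2 < real (Suc k)" using N that by linarith
        then have "4 < real (Suc k) * e\<^sup>2" using pos by (simp add: divide_less_eq)
        then show ?thesis by (simp add: field_simps)
      qed
      then have "(norm (s m - s n))\<^sup>2 < e\<^sup>2" using est[of m n] that by (smt (verit) field_sum_of_halves)
      then show ?thesis using \<open>0 < e\<close> by (meson less_imp_le power_less_imp_less_base)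
    qed
    then show "\<exists>M. \<forall>m\<ge>M. \<forall>n\<ge>M. norm (s m - s n) < e" by blast
  qed
  then obtain p where p: "p \<in> H" "s \<longlonglongrightarrow> p"
    using com s(1) unfolding complete_def by blast
  have "(\<lambda>n. (norm (x - s n))\<^sup>2) \<longlonglongrightarrow> (norm (x - p))\<^sup>2"
    by (intro tendsto_intros p)
  moreover have "(\<lambda>n. d + 1 / real (Suc n)) \<longlonglongrightarrow> d + 0"
    by (intro tendsto_intros LIMSEQ_Suc lim_1_over_n)
  ultimately have "(norm (x - p))\<^sup>2 \<le> d + 0"
    by (rule LIMSEQ_le) (use s(2) less_imp_le in blast)
  then have min: "(norm (x - p))\<^sup>2 \<le> d" by simp
  have "(x - p) \<bullet> h = 0" if "h \<in> H" for h
  proof (rule linear_coefficient_zero[of "h \<bullet> h"])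
    fix t :: real
    have "p + t *\<^sub>R h \<in> H" using that p sub by (intro subspace_add subspace_scale) auto
    then have "(norm (x - p))\<^sup>2 \<le> (norm (x - (p + t *\<^sub>R h)))\<^sup>2"
      by (rule order_trans[OF min d_le])
    then show "0 \<le> t * t * (h \<bullet> h) - 2 * t * ((x - p) \<bullet> h)"
      by (simp add: power2_norm_eq_inner inner_diff inner_add inner_commute algebra_simps)
  qed
  then show ?thesis using p by blast
qed

context
  fixes H :: "'a::real_inner set"
  assumes H: "real_hilbert_space H"
begin

lemma hproj_in: "hproj H x \<in> H"
  and hproj_orth: "h \<in> H \<Longrightarrow> (x - hproj H x) \<bullet> h = 0"
  using someI_ex[OF orthogonal_projection_exists[OF H, of x]] unfolding hproj_def by blast+

lemma hproj_eqI:
  assumes "p \<in> H" "\<And>h. h \<in> H \<Longrightarrow> (x - p) \<bullet> h = 0"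
  shows "hproj H x = p"
proof -
  have "hproj H x - p \<in> H"
    using assms(1) hproj_in H by (auto simp: real_hilbert_space_def intro: subspace_diff)
  then have "(x - p) \<bullet> (hproj H x - p) - (x - hproj H x) \<bullet> (hproj H x - p) = 0"
    using assms(2) hproj_orth by simp
  then have "(hproj H x - p) \<bullet> (hproj H x - p) = 0" by (simp add: inner_diff)
  then show ?thesis by simp
qed

lemma hproj_id: "x \<in> H \<Longrightarrow> hproj H x = x"
  by (rule hproj_eqI) auto

lemma hproj_hproj: "hproj H (hproj H x) = hproj H x"
  by (rule hproj_id) (rule hproj_in)

lemma hproj_inner: "h \<in> H \<Longrightarrow> hproj H x \<bullet> h = x \<bullet> h"
  using hproj_orth[of h x] by (simp add: inner_diff)

lemma hproj_sym: "hproj H x \<bullet> y = x \<bullet> hproj H y"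
  using hproj_inner[OF hproj_in, of x y] hproj_inner[OF hproj_in, of y x]
  by (simp add: inner_commute)

lemma norm_hproj_le: "norm (hproj H x) \<le> norm x"
proof -
  have "(norm (hproj H x))\<^sup>2 = x \<bullet> hproj H x"
    by (simp add: power2_norm_eq_inner hproj_inner hproj_in)
  also have "\<dots> \<le> norm x * norm (hproj H x)" by (rule norm_cauchy_schwarz)
  finally show ?thesis 
    by (metis mult_le_cancel_right norm_ge_zero order_le_less power2_eq_square)
qed

lemma bounded_linear_hproj: "bounded_linear (hproj H)"
proof (rule bounded_linear_intro)
  have sub: "subspace H" using H by (simp add: real_hilbert_space_def)
  show "hproj H (x + y) = hproj H x + hproj H y" for x y
    using hproj_orth
    by (intro hproj_eqI subspace_add[OF sub] hproj_in)
      (metis add_diff_add add.right_neutral inner_add_left)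
  show "hproj H (r *\<^sub>R x) = r *\<^sub>R hproj H x" for r x
    using hproj_orth
    by (intro hproj_eqI subspace_scale[OF sub] hproj_in)
      (metis inner_scaleR_left mult_zero_right scaleR_diff_right)
  show "norm (hproj H x) \<le> norm x * 1" for x using norm_hproj_le by simp
qed

text \<open>
  A functional that factors through the projection onto \<open>H\<close> is represented by a multiple of a vector
  of \<open>H\<close> orthogonal to its kernel; such a vector comes from projecting onto the kernel.
\<close>

lemma riesz_representation:
  assumes f: "bounded_linear f" "\<And>x. f (hproj H x) = f x"
  shows "\<exists>r\<in>H. \<forall>x. f x = x \<bullet> (r::'a)"
proof -
  interpret f: bounded_linear f by fact
  have sub: "subspace H" and com: "complete H" using H by (auto simp: real_hilbert_space_def)
  define N where "N = {x \<in> H. f x = 0}"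
  have "N = H \<inter> f -` {0}" by (auto simp: N_def)
  moreover have "closed (f -` {0})"
    using f.continuous_on[OF continuous_on_id] by (intro closed_vimage) auto
  ultimately have "complete N" using com by (metis complete_Int_closed)
  moreover have "subspace N"
    using sub by (auto simp: N_def subspace_def f.add f.scaleR f.zero)
  ultimately have N: "real_hilbert_space N" by (simp add: real_hilbert_space_def)
  show ?thesis
  proof (cases "\<exists>x\<in>H. f x \<noteq> 0")
    case False
    then have "f x = x \<bullet> 0" for x using f(2)[of x] hproj_in by force
    then show ?thesis using subspace_0[OF sub] by blast
  next
    case True
    then obtain x0 where x0: "x0 \<in> H" "f x0 \<noteq> 0" by blast
    obtain p where p: "p \<in> N" "\<forall>h\<in>N. (x0 - p) \<bullet> h = 0"
      using orthogonal_projection_exists[OF N] by blast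
    define u where "u = x0 - p"
    have u: "u \<in> H" "f u = f x0"
      using x0 p sub by (auto simp: u_def N_def f.diff intro: subspace_diff)
    then have fu: "f u \<noteq> 0" using x0 by simp
    then have uu: "u \<bullet> u \<noteq> 0" by (auto simp: f.zero)
    have key: "f x = x \<bullet> ((f u / (u \<bullet> u)) *\<^sub>R u)" if "x \<in> H" for x
    proof -
      have "x - (f x / f u) *\<^sub>R u \<in> N"
        using that u fu sub
        by (auto simp: N_def f.diff f.scaleR intro!: subspace_diff subspace_scale)
      then have "u \<bullet> (x - (f x / f u) *\<^sub>R u) = 0" using p unfolding u_def by blast
      then have "f u * (x \<bullet> u) = f x * (u \<bullet> u)"
        using fu by (simp add: inner_diff inner_commute field_simps)
      then show ?thesis using uu by (simp add: field_simps)
    qed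
    have "f x = x \<bullet> ((f u / (u \<bullet> u)) *\<^sub>R u)" for x
      using key[OF hproj_in, of x] f(2)[of x] u by (simp add: hproj_inner)
    then show ?thesis using u sub by (blast intro: subspace_scale)
  qed
qed

end

text \<open>
  The working notion of operator from \<open>H\<close> to \<open>K\<close>: instead of a function known only on \<open>H\<close>, its
  extension by zero on the orthogonal complement of \<open>H\<close>.  Such maps are linear on the whole type, so
  identities between compositions hold for all arguments and need no membership side conditions.
  The identity operator of \<open>H\<close> becomes \<open>hproj H\<close>.
\<close>

definition hilbert_map :: "'a::real_inner set \<Rightarrow> 'b::real_inner set \<Rightarrow> ('a \<Rightarrow> 'b) \<Rightarrow> bool" where
  "hilbert_map H K f \<longleftrightarrow>
     bounded_linear f \<and> (\<forall>x. f x \<in> K) \<and> (\<forall>x. f (hproj H x) = f x)"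

lemma hilbert_mapD:
  assumes "hilbert_map H K f"
  shows "bounded_linear f" "f x \<in> K" "f (hproj H x) = f x"
    "linear f" "f (x + y) = f x + f y" "f (x - y) = f x - f y" "f (- x) = - f x"
    "f (c *\<^sub>R x) = c *\<^sub>R f x" "f 0 = 0"
  using assms by (auto simp: hilbert_map_def bounded_linear.linear linear_add linear_diff
      linear_neg linear_scale linear_0)

lemma hilbert_map_compose:
  assumes "hilbert_map H K f" "hilbert_map K M g"
  shows "hilbert_map H M (\<lambda>x. g (f x))"
  using assms by (auto simp: hilbert_map_def intro: bounded_linear_compose)

lemma hilbert_map_hproj: "real_hilbert_space H \<Longrightarrow> hilbert_map H H (hproj H)"
  by (simp add: hilbert_map_def bounded_linear_hproj hproj_in hproj_hproj)

lemma hilbert_map_diff: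
  assumes "real_hilbert_space K" "hilbert_map H K f" "hilbert_map H K g"
  shows "hilbert_map H K (\<lambda>x. f x - g x)"
  using assms
  by (auto simp: hilbert_map_def real_hilbert_space_def intro: bounded_linear_sub subspace_diff)

lemma hilbert_map_add:
  assumes "real_hilbert_space K" "hilbert_map H K f" "hilbert_map H K g"
  shows "hilbert_map H K (\<lambda>x. f x + g x)"
  using assms
  by (auto simp: hilbert_map_def real_hilbert_space_def intro: bounded_linear_add subspace_add)

lemma hilbert_map_scaleR:
  assumes "real_hilbert_space K" "hilbert_map H K f"
  shows "hilbert_map H K (\<lambda>x. c *\<^sub>R f x)"
  using assms
  by (auto simp: hilbert_map_def real_hilbert_space_def
      intro: bounded_linear_const_scaleR subspace_scale)

lemma hilbert_map_minus:
  assumes "real_hilbert_space K" "hilbert_map H K f"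
  shows "hilbert_map H K (\<lambda>x. - f x)"
  using hilbert_map_scaleR[OF assms, of "-1"] by simp

lemma hilbert_map_bound:
  assumes "hilbert_map H K f"
  obtains C where "0 < C" "\<And>x. norm (f x) \<le> C * norm x"
proof -
  obtain C where "C > 0" "\<forall>x. norm (f x) \<le> norm x * C"
    using bounded_linear.pos_bounded[OF hilbert_mapD(1)[OF assms]] by blast
  then show thesis using that[of C] by (simp add: mult.commute)
qed

lemma hproj_fixes: "real_hilbert_space K \<Longrightarrow> hilbert_map H K f \<Longrightarrow> hproj K (f x) = f x"
  by (simp add: hilbert_mapD(2) hproj_id)

definition adjoint_maps :: "('a::real_inner \<Rightarrow> 'b::real_inner) \<Rightarrow> ('b \<Rightarrow> 'a) \<Rightarrow> bool" where
  "adjoint_maps f g \<longleftrightarrow> (\<forall>x y. f x \<bullet> y = x \<bullet> g y)"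

lemma adjoint_mapsD: "adjoint_maps f g \<Longrightarrow> f x \<bullet> y = x \<bullet> g y"
  by (simp add: adjoint_maps_def)

lemma adjoint_maps_sym: "adjoint_maps f g \<Longrightarrow> adjoint_maps g f"
  by (metis adjoint_maps_def inner_commute)

lemma adjoint_maps_compose:
  "adjoint_maps f f' \<Longrightarrow> adjoint_maps g g' \<Longrightarrow>
    adjoint_maps (\<lambda>x. g (f x)) (\<lambda>x. f' (g' x))"
  by (simp add: adjoint_maps_def)

lemma adjoint_maps_unique:
  assumes "adjoint_maps f g" "adjoint_maps f h"
  shows "g x = h x"
  using assms by (metis adjoint_maps_def vector_eq_ldot)

lemma adjoint_maps_hproj: "real_hilbert_space H \<Longrightarrow> adjoint_maps (hproj H) (hproj H)"
  by (simp add: adjoint_maps_def hproj_sym)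

text \<open>
  For fixed \<open>y\<close> the functional \<open>x \<mapsto> f x \<bullet> y\<close> has a Riesz representative in \<open>H\<close>, and this is the
  value of the adjoint at \<open>y\<close>.
\<close>

lemma adjoint_exists:
  fixes f :: "'a::real_inner \<Rightarrow> 'b::real_inner"
  assumes H: "real_hilbert_space H" and K: "real_hilbert_space K" and f: "hilbert_map H K f"
  shows "\<exists>g. hilbert_map K H g \<and> adjoint_maps f g"
proof -
  have "\<exists>r\<in>H. \<forall>x. f x \<bullet> y = x \<bullet> r" for y
    using riesz_representation[OF H, of "\<lambda>x. f x \<bullet> y"] f
    by (simp add: hilbert_map_def bounded_linear_inner_left_comp)
  then obtain g where g: "\<And>y. g y \<in> H" "\<And>x y. f x \<bullet> y = x \<bullet> g y" by metis
  obtain C where C: "0 < C" "\<And>x. norm (f x) \<le> C * norm x" using hilbert_map_bound[OF f] by blast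
  have eqI: "a = b" if "\<And>x. x \<bullet> a = x \<bullet> b" for a b :: 'a
    using that by (metis vector_eq_ldot)
  have "bounded_linear g"
  proof (rule bounded_linear_intro)
    show "g (x + y) = g x + g y" for x y by (rule eqI) (simp add: inner_add g(2)[symmetric])
    show "g (r *\<^sub>R x) = r *\<^sub>R g x" for r x by (rule eqI) (simp add: g(2)[symmetric])
    show "norm (g y) \<le> norm y * C" for y
    proof -
      have "norm (g y) * norm (g y) = f (g y) \<bullet> y"
        by (simp add: g(2) flip: power2_eq_square power2_norm_eq_inner)
      also have "\<dots> \<le> norm (f (g y)) * norm y" by (rule norm_cauchy_schwarz)
      also have "\<dots> \<le> C * norm (g y) * norm y" by (intro mult_right_mono C) auto
      finally have "norm (g y) * norm (g y) \<le> norm (g y) * (norm y * C)" by (simp add: ac_simps)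
      then show ?thesis using C(1)
        by (metis mult_le_cancel_left_pos norm_ge_zero order_le_less mult_nonneg_nonneg)
    qed
  qed
  moreover have "g (hproj K y) = g y" for y
    by (rule eqI) (simp add: g(2)[symmetric] hproj_sym[OF K, symmetric] hproj_fixes[OF K f])
  ultimately show ?thesis using g by (auto simp: hilbert_map_def adjoint_maps_def)
qed

section \<open>Square roots of positive operators\<close>

text \<open>
  With \<open>A = I - T\<close> the equation \<open>(I - Y)\<^sup>2 = T\<close> becomes the fixed-point equation
  \<open>Y = (A + Y\<^sup>2) / 2\<close>; the following sequence iterates it.
\<close>

primrec sqrt_iter :: "('a::real_inner \<Rightarrow> 'a) \<Rightarrow> nat \<Rightarrow> 'a \<Rightarrow> 'a" where
  "sqrt_iter A 0 = (\<lambda>x. 0)"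
| "sqrt_iter A (Suc n) = (\<lambda>x. (1/2) *\<^sub>R (A x + sqrt_iter A n (sqrt_iter A n x)))"

text \<open>
  The same iteration for the number \<open>A = 1\<close>.  Every iterate is a polynomial in \<open>A\<close> with
  non-negative coefficients, so for a contraction \<open>A\<close> this scalar sequence dominates the
  operator sequence and its increments.
\<close>

primrec sqrt_majorant :: "nat \<Rightarrow> real" where
  "sqrt_majorant 0 = 0"
| "sqrt_majorant (Suc n) = (1 + sqrt_majorant n * sqrt_majorant n) / 2"

lemma sqrt_majorant_bounds: "0 \<le> sqrt_majorant n" "sqrt_majorant n \<le> 1"
proof -
  have "0 \<le> sqrt_majorant n \<and> sqrt_majorant n \<le> 1"
    by (induction n) (auto intro: mult_le_one)
  then show "0 \<le> sqrt_majorant n" "sqrt_majorant n \<le> 1" by auto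
qed

lemma sqrt_majorant_mono: "incseq sqrt_majorant"
proof (rule incseq_SucI)
  fix n
  have "0 \<le> (1 - sqrt_majorant n)\<^sup>2" by simp
  then show "sqrt_majorant n \<le> sqrt_majorant (Suc n)"
    by (simp add: power2_eq_square algebra_simps)
qed

text \<open>
  The increments of the operator iteration are bounded in norm by the increments of the bounded
  increasing scalar sequence, so the iterates converge uniformly on bounded sets.  The limiting
  case \<open>\<parallel>A\<parallel> = 1\<close> is covered, which is the one that arises for operators without bounded inverse.
  As a limit of polynomials in \<open>A\<close>, the fixed point commutes with everything that commutes
  with \<open>A\<close>.
\<close>

lemma sqrt_fixed_point:
  fixes A :: "'a::real_inner \<Rightarrow> 'a"
  assumes H: "real_hilbert_space H" and A: "hilbert_map H H A" "adjoint_maps A A"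
    and contr: "\<And>x. norm (A x) \<le> norm x"
  obtains Y where "hilbert_map H H Y" "adjoint_maps Y Y" "\<And>x. norm (Y x) \<le> norm x"
    "\<And>x. 2 *\<^sub>R Y x = A x + Y (Y x)"
    "\<And>C x. hilbert_map H H C \<Longrightarrow> (\<And>x. C (A x) = A (C x)) \<Longrightarrow> C (Y x) = Y (C x)"
proof -
  define Y where "Y = sqrt_iter A"
  define y where "y = sqrt_majorant"
  note y = sqrt_majorant_bounds[folded y_def]
  have Y0: "Y 0 x = 0" and YS: "Y (Suc n) x = (1/2) *\<^sub>R (A x + Y n (Y n x))" for n x
    by (simp_all add: Y_def)
  have ySuc: "y (Suc n) = (1 + y n * y n) / 2" for n by (simp add: y_def)
  have sub: "subspace H" and com: "complete H" using H by (auto simp: real_hilbert_space_def)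
  have YH: "hilbert_map H H (Y n)" for n
  proof (induction n)
    case 0
    have "Y 0 = (\<lambda>x. 0)" by (simp add: Y_def)
    then show ?case using subspace_0[OF sub] by (simp add: hilbert_map_def bounded_linear_zero)
  next
    case (Suc n)
    have "Y (Suc n) = (\<lambda>x. (1/2) *\<^sub>R (A x + Y n (Y n x)))" by (simp add: Y_def)
    then show ?case
      using hilbert_map_scaleR[OF H hilbert_map_add[OF H A(1) hilbert_map_compose[OF Suc Suc]]]
      by simp
  qed
  have Ysym: "Y n x \<bullet> z = x \<bullet> Y n z" for n x z
    by (induction n arbitrary: x z)
      (simp_all add: Y0 YS inner_add adjoint_mapsD[OF A(2)])
  have Ybd: "norm (Y n x) \<le> y n * norm x" for n x
  proof (induction n arbitrary: x)
    case 0
    show ?case using y(1)[of 0] by (simp add: Y0)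
  next
    case (Suc n)
    have "norm (Y n (Y n x)) \<le> y n * norm (Y n x)" by (rule Suc)
    also have "\<dots> \<le> y n * (y n * norm x)" by (intro mult_left_mono Suc y)
    finally have "norm (A x + Y n (Y n x)) \<le> norm x + y n * (y n * norm x)"
      using contr[of x] norm_triangle_mono by blast
    then show ?case unfolding YS ySuc norm_scaleR by (simp add: field_simps)
  qed
  have Ybd1: "norm (Y n x) \<le> norm x" for n x
    using Ybd[of n x] y(2)[of n] mult_right_mono[OF y(2)[of n] norm_ge_zero[of x]] by linarith
  have Ycomm: "C (Y n x) = Y n (C x)"
    if C: "hilbert_map H H C" "\<And>x. C (A x) = A (C x)" for C n x
    by (induction n arbitrary: x) (simp_all add: Y0 YS hilbert_mapD[OF C(1)] C(2))
  have step: "norm (Y (Suc n) x - Y n x) \<le> (y (Suc n) - y n) * norm x" for n x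
  proof (induction n arbitrary: x)
    case 0
    show ?case using contr[of x] by (simp add: YS Y0 ySuc y_def)
  next
    case (Suc n)
    \<comment> \<open>With \<open>D = Y' - Y\<close> one has \<open>Y' Y' - Y Y = Y' D + D Y\<close>, the operator form of a difference of squares.\<close>
    let ?D = "\<lambda>x. Y (Suc n) x - Y n x"
    have "Y (Suc (Suc n)) x - Y (Suc n) x =
        (1/2) *\<^sub>R (A x + Y (Suc n) (Y (Suc n) x)) - (1/2) *\<^sub>R (A x + Y n (Y n x))"
      by (rule arg_cong2[where f = "(-)", OF YS YS])
    also have "\<dots> = (1/2) *\<^sub>R (Y (Suc n) (?D x) + ?D (Y n x))"
      by (simp add: hilbert_mapD(6)[OF YH] algebra_simps)
    finally have "Y (Suc (Suc n)) x - Y (Suc n) x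
        = (1/2) *\<^sub>R (Y (Suc n) (?D x) + ?D (Y n x))" .
    moreover have "norm (Y (Suc n) (?D x)) \<le> y (Suc n) * ((y (Suc n) - y n) * norm x)"
      by (rule order_trans[OF Ybd mult_left_mono[OF Suc y(1)]])
    moreover have "norm (?D (Y n x)) \<le> (y (Suc n) - y n) * (y n * norm x)"
      using sqrt_majorant_mono
      by (intro order_trans[OF Suc mult_left_mono[OF Ybd]]) (simp add: y_def incseq_Suc_iff)
    ultimately have "norm (Y (Suc (Suc n)) x - Y (Suc n) x)
        \<le> 1/2 * (y (Suc n) * ((y (Suc n) - y n) * norm x) + (y (Suc n) - y n) * (y n * norm x))"
      using norm_triangle_ineq[of "Y (Suc n) (?D x)" "?D (Y n x)"] by simp
    also have "\<dots> = (y (Suc (Suc n)) - y (Suc n)) * norm x"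
      unfolding arg_cong2[where f = "(-)", OF ySuc ySuc] by (simp add: algebra_simps)
    finally show ?case .
  qed
  have diff: "norm (Y (n + k) x - Y n x) \<le> (y (n + k) - y n) * norm x" for n k x
  proof (induction k)
    case (Suc k)
    have "norm (Y (n + Suc k) x - Y n x)
        \<le> norm (Y (Suc (n + k)) x - Y (n + k) x) + norm (Y (n + k) x - Y n x)"
      using norm_triangle_ineq[of "Y (Suc (n + k)) x - Y (n + k) x" "Y (n + k) x - Y n x"] by simp
    also have "\<dots> \<le> (y (Suc (n + k)) - y (n + k)) * norm x + (y (n + k) - y n) * norm x"
      by (rule add_mono[OF step Suc])
    finally show ?case by (simp add: algebra_simps)
  qed simp
  have "\<exists>l\<in>H. (\<lambda>n. Y n x) \<longlonglongrightarrow> l" for x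
  proof -
    have "convergent y"
      using sqrt_majorant_mono y(2) unfolding y_def by (metis incseq_convergent convergentI)
    then have "Cauchy (\<lambda>n. y n * norm x)"
      by (intro convergent_Cauchy convergent_mult convergent_const)
    then have yC: "\<exists>M. \<forall>m\<ge>M. \<forall>n\<ge>M. \<bar>y m * norm x - y n * norm x\<bar> < e" if "e > 0" for e
      using that by (metis CauchyD real_norm_def)
    have le: "norm (Y m x - Y n x) \<le> \<bar>y m * norm x - y n * norm x\<bar>" for m n
    proof (cases "n \<le> m")
      case True
      then show ?thesis using diff[of n "m - n" x] by (simp add: algebra_simps)
    next
      case False
      then show ?thesis using diff[of m "n - m" x] by (simp add: algebra_simps norm_minus_commute)
    qed
    have "Cauchy (\<lambda>n. Y n x)"
    proof (rule CauchyI)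
      fix e :: real assume "0 < e"
      then obtain M where "\<forall>m\<ge>M. \<forall>n\<ge>M. \<bar>y m * norm x - y n * norm x\<bar> < e" using yC by blast
      then have "\<forall>m\<ge>M. \<forall>n\<ge>M. norm (Y m x - Y n x) < e"
        using order_le_less_trans[OF le] by blast
      then show "\<exists>M. \<forall>m\<ge>M. \<forall>n\<ge>M. norm (Y m x - Y n x) < e" by blast
    qed
    moreover have "\<forall>n. Y n x \<in> H" using hilbert_mapD(2)[OF YH] by simp
    ultimately show ?thesis using com unfolding complete_def by (metis (no_types))
  qed
  then have "\<forall>x. \<exists>l. l \<in> H \<and> (\<lambda>n. Y n x) \<longlonglongrightarrow> l" by blast
  from choice[OF this] obtain Z
    where Z: "\<And>x. Z x \<in> H" "\<And>x. (\<lambda>n. Y n x) \<longlonglongrightarrow> Z x" by blast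
  have Zbd: "norm (Z x) \<le> norm x" for x
    by (rule LIMSEQ_le_const2[OF tendsto_norm[OF Z(2)]]) (use Ybd1 in blast)
  have Zadd: "Z (u + v) = Z u + Z v" for u v
    using LIMSEQ_unique[OF Z(2)[of "u + v"]] tendsto_add[OF Z(2)[of u] Z(2)[of v]]
    by (simp add: hilbert_mapD[OF YH])
  have Zscale: "Z (c *\<^sub>R u) = c *\<^sub>R Z u" for c u
    using LIMSEQ_unique[OF Z(2)[of "c *\<^sub>R u"]] tendsto_scaleR[OF tendsto_const Z(2)[of u], of c]
    by (simp add: hilbert_mapD[OF YH])
  have ZH: "hilbert_map H H Z"
    unfolding hilbert_map_def
  proof (intro conjI allI)
    show "bounded_linear Z"
      by (rule bounded_linear_intro[of _ 1]) (simp_all add: Zadd Zscale Zbd)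
    show "Z (hproj H x) = Z x" for x
      using LIMSEQ_unique[OF Z(2)[of x]] Z(2)[of "hproj H x"]
      by (simp add: hilbert_mapD(3)[OF YH])
  qed (rule Z)
  have Zsym: "Z x \<bullet> z = x \<bullet> Z z" for x z
  proof (rule LIMSEQ_unique)
    show "(\<lambda>n. Y n x \<bullet> z) \<longlonglongrightarrow> Z x \<bullet> z" by (intro tendsto_intros Z)
    show "(\<lambda>n. Y n x \<bullet> z) \<longlonglongrightarrow> x \<bullet> Z z" unfolding Ysym by (intro tendsto_intros Z)
  qed
  have fixp: "2 *\<^sub>R Z x = A x + Z (Z x)" for x
  proof -
    have "(\<lambda>n. Y n (Y n x) - Y n (Z x)) \<longlonglongrightarrow> 0"
    proof (rule Lim_null_comparison[OF always_eventually])
      show "\<forall>n. norm (Y n (Y n x) - Y n (Z x)) \<le> norm (Y n x - Z x)"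
        using Ybd1 hilbert_mapD(6)[OF YH] by metis
      show "(\<lambda>n. norm (Y n x - Z x)) \<longlonglongrightarrow> 0"
        using Z(2)[of x] by (simp add: LIM_zero tendsto_norm_zero)
    qed
    then have YY: "(\<lambda>n. Y n (Y n x)) \<longlonglongrightarrow> Z (Z x)"
      using Z(2)[of "Z x"] by (metis Lim_transform)
    have "(\<lambda>n. 2 *\<^sub>R Y (Suc n) x) \<longlonglongrightarrow> 2 *\<^sub>R Z x"
      by (intro tendsto_intros LIMSEQ_Suc Z)
    moreover have "(\<lambda>n. 2 *\<^sub>R Y (Suc n) x) \<longlonglongrightarrow> A x + Z (Z x)"
      unfolding YS by (simp, intro tendsto_intros YY)
    ultimately show ?thesis by (rule LIMSEQ_unique)
  qed
  have comm: "C (Z x) = Z (C x)"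
    if C: "hilbert_map H H C" "\<And>x. C (A x) = A (C x)" for C x
  proof (rule LIMSEQ_unique)
    show "(\<lambda>n. C (Y n x)) \<longlonglongrightarrow> C (Z x)"
      by (rule bounded_linear.tendsto[OF hilbert_mapD(1)[OF C(1)] Z(2)])
    show "(\<lambda>n. C (Y n x)) \<longlonglongrightarrow> Z (C x)" using Z(2)[of "C x"] by (simp add: Ycomm[OF C])
  qed
  show thesis
    using that[of Z] ZH Zsym Zbd fixp comm by (auto simp: adjoint_maps_def)
qed

text \<open>
  After division by a norm bound \<open>c\<close> the operator \<open>A = I - T / c\<close> is a contraction, and the fixed
  point \<open>Y\<close> for \<open>A\<close> yields \<open>R = sqrt c (I - Y)\<close>.
\<close>

lemma positive_square_root:
  fixes T :: "'a::real_inner \<Rightarrow> 'a"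
  assumes H: "real_hilbert_space H" and T: "hilbert_map H H T" "adjoint_maps T T"
    and pos: "\<And>x. 0 \<le> x \<bullet> T x"
  obtains R where "hilbert_map H H R" "adjoint_maps R R" "\<And>x. 0 \<le> x \<bullet> R x"
    "\<And>x. R (R x) = T x"
    "\<And>C x. hilbert_map H H C \<Longrightarrow> (\<And>x. C (T x) = T (C x)) \<Longrightarrow> C (R x) = R (C x)"
proof -
  obtain c where c: "0 < c" "\<And>x. norm (T x) \<le> c * norm x" using hilbert_map_bound[OF T(1)] by blast
  define p where "p = hproj H"
  have p: "hilbert_map H H p" "adjoint_maps p p"
    by (simp_all add: p_def H hilbert_map_hproj adjoint_maps_hproj)
  note pid = hproj_fixes[OF H, folded p_def] and pfix = hilbert_mapD(3)[where H = H, folded p_def]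
  define A where "A = (\<lambda>x. p x - (1/c) *\<^sub>R T x)"
  have A: "hilbert_map H H A" "adjoint_maps A A"
  proof -
    show "hilbert_map H H A" unfolding A_def
      by (intro hilbert_map_diff hilbert_map_scaleR H T p)
    show "adjoint_maps A A"
      using T(2) p(2) by (simp add: A_def adjoint_maps_def inner_diff)
  qed
  have contr: "norm (A x) \<le> norm x" for x
  proof -
    define q where "q = p x"
    have Aq: "A x = q - (1/c) *\<^sub>R T q"
      by (simp add: A_def q_def pfix[OF T(1)])
    \<comment> \<open>Positivity of \<open>T\<close> at this particular \<open>z\<close> gives \<open>\<parallel>T q\<parallel>\<^sup>2 \<le> c (q \<bullet> T q)\<close>,
      which makes \<open>I - T / c\<close> a contraction.\<close>
    define z where "z = q - (1/c) *\<^sub>R T q"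
    have "norm (T (T q)) \<le> c * norm (T q)" by (rule c)
    then have "T q \<bullet> T (T q) \<le> norm (T q) * (c * norm (T q))"
      using norm_cauchy_schwarz[of "T q" "T (T q)"] by (meson mult_left_mono norm_ge_zero order_trans)
    then have 1: "T q \<bullet> T (T q) \<le> c * (T q \<bullet> T q)"
      by (simp add: dot_square_norm power2_eq_square ac_simps)
    have "z \<bullet> T z = q \<bullet> T q - 2 * (1/c) * (T q \<bullet> T q) + (1/c) * (1/c) * (T q \<bullet> T (T q))"
      unfolding z_def
      by (simp add: hilbert_mapD[OF T(1)] inner_diff adjoint_mapsD[OF T(2), of q "T q"] algebra_simps)
    also have "\<dots> \<le> q \<bullet> T q - 2 * (1/c) * (T q \<bullet> T q) + (1/c) * (1/c) * (c * (T q \<bullet> T q))"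
      using c(1) 1 by (intro add_left_mono mult_left_mono) auto
    also have "\<dots> = q \<bullet> T q - (1/c) * (T q \<bullet> T q)" using c(1) by simp
    finally have 2: "(1/c) * (T q \<bullet> T q) \<le> q \<bullet> T q" using pos[of z] by linarith
    have "(norm (A x))\<^sup>2 = (norm q)\<^sup>2 - 2 * (1/c) * (q \<bullet> T q) + (1/c) * ((1/c) * (T q \<bullet> T q))"
      by (simp add: Aq power2_norm_eq_inner inner_diff inner_commute algebra_simps)
    also have "\<dots> \<le> (norm q)\<^sup>2 - 2 * (1/c) * (q \<bullet> T q) + (1/c) * (q \<bullet> T q)"
      using c(1) 2 by (intro add_left_mono mult_left_mono) auto
    also have "\<dots> \<le> (norm q)\<^sup>2"
      using c(1) pos[of q] by simp
    finally have "norm (A x) \<le> norm q" by simp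
    also have "\<dots> \<le> norm x" by (simp add: q_def p_def norm_hproj_le[OF H])
    finally show ?thesis .
  qed
  obtain Y where Y: "hilbert_map H H Y" "adjoint_maps Y Y" "\<And>x. norm (Y x) \<le> norm x"
    "\<And>x. 2 *\<^sub>R Y x = A x + Y (Y x)"
    "\<And>C x. hilbert_map H H C \<Longrightarrow> (\<And>x. C (A x) = A (C x)) \<Longrightarrow> C (Y x) = Y (C x)"
    using sqrt_fixed_point[OF H A contr] by blast
  define R where "R = (\<lambda>x. sqrt c *\<^sub>R (p x - Y x))"
  show thesis
  proof (rule that[of R])
    show R: "hilbert_map H H R" unfolding R_def
      by (intro hilbert_map_diff hilbert_map_scaleR H Y p)
    show "adjoint_maps R R"
      using Y(2) p(2) by (simp add: R_def adjoint_maps_def inner_diff)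
    show "0 \<le> x \<bullet> R x" for x
    proof -
      have "x \<bullet> Y x = p x \<bullet> Y (p x)"
        by (metis Y(1) p_def pfix H hilbert_mapD(2) hproj_inner)
      also have "\<dots> \<le> norm (p x) * norm (p x)"
        using norm_cauchy_schwarz[of "p x" "Y (p x)"] Y(3)[of "p x"]
        by (meson mult_left_mono norm_ge_zero order_trans)
      also have "\<dots> = x \<bullet> p x"
        by (metis p_def H hproj_in hproj_inner dot_square_norm power2_eq_square)
      finally show ?thesis using c(1) by (simp add: R_def inner_diff)
    qed
    show "R (R x) = T x" for x
    proof -
      have "R (R x) = c *\<^sub>R (p x - 2 *\<^sub>R Y x + Y (Y x))"
        using c(1) by (simp add: R_def hilbert_mapD[OF Y(1)] hilbert_mapD[OF p(1)] pid[OF Y(1)]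
            pid[OF p(1)] pfix[OF Y(1)] algebra_simps scaleR_2)
      also have "\<dots> = c *\<^sub>R (p x - A x)" by (simp add: Y(4))
      also have "\<dots> = T x" using c(1) by (simp add: A_def)
      finally show ?thesis .
    qed
    show "C (R x) = R (C x)" if C: "hilbert_map H H C" "\<And>x. C (T x) = T (C x)" for C x
    proof -
      have "C (A x) = A (C x)" for x
        by (simp add: A_def hilbert_mapD[OF C(1)] pfix[OF C(1)] pid[OF C(1)] C(2))
      then have "C (Y x) = Y (C x)" by (rule Y(5)[OF C(1)])
      then show ?thesis
        by (simp add: R_def hilbert_mapD[OF C(1)] pfix[OF C(1)] pid[OF C(1)])
    qed
  qed
qed

section \<open>Rigidity of symplectic congruences\<close>

lemma complete_Times:
  fixes A :: "'a::metric_space set" and B :: "'b::metric_space set"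
  assumes "complete A" "complete B"
  shows "complete (A \<times> B)"
  unfolding complete_def
proof (intro allI impI, elim conjE)
  fix f assume f: "\<forall>n. f n \<in> A \<times> B" "Cauchy f"
  obtain a where a: "a \<in> A" "(\<lambda>n. fst (f n)) \<longlonglongrightarrow> a"
    using assms(1) f(1) Cauchy_fst[OF f(2)] unfolding complete_def mem_Times_iff by meson
  obtain b where b: "b \<in> B" "(\<lambda>n. snd (f n)) \<longlonglongrightarrow> b"
    using assms(2) f(1) Cauchy_snd[OF f(2)] unfolding complete_def mem_Times_iff by meson
  have "f \<longlonglongrightarrow> (a, b)" using tendsto_Pair[OF a(2) b(2)] by simp
  then show "\<exists>l\<in>A \<times> B. f \<longlonglongrightarrow> l" using a b by blast
qed

lemma real_hilbert_space_Times:
  assumes "real_hilbert_space H" "real_hilbert_space K"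
  shows "real_hilbert_space (H \<times> K)"
  using assms by (auto simp: real_hilbert_space_def subspace_Times intro: complete_Times)

lemma hproj_Times:
  assumes "real_hilbert_space H" "real_hilbert_space K"
  shows "hproj (H \<times> K) v = (hproj H (fst v), hproj K (snd v))"
proof (rule hproj_eqI[OF real_hilbert_space_Times[OF assms]])
  show "(hproj H (fst v), hproj K (snd v)) \<in> H \<times> K"
    using assms by (simp add: hproj_in)
  fix h assume "h \<in> H \<times> K"
  then show "(v - (hproj H (fst v), hproj K (snd v))) \<bullet> h = 0"
    using assms by (auto simp: inner_prod_def hproj_orth)
qed

text \<open>
  The involution \<open>J\<close> on the whole product type, without restriction to a carrier.
\<close>

definition rot :: "'a::real_inner \<times> 'a \<Rightarrow> 'a \<times> 'a" where
  "rot v = (- snd v, fst v)"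

lemma rot_simps [simp]:
  "fst (rot v) = - snd v" "snd (rot v) = fst v" "rot (x, y) = (- y, x)" "rot (rot v) = - v"
  "rot (u - v) = rot u - rot v" "rot (- v) = - rot v"
  by (auto simp: rot_def prod_eq_iff)

lemma hproj_0: "real_hilbert_space H \<Longrightarrow> hproj H 0 = 0"
  by (rule hproj_id) (auto simp: real_hilbert_space_def subspace_0)

lemma hproj_minus: "real_hilbert_space H \<Longrightarrow> hproj H (- x) = - hproj H x"
  by (rule hilbert_mapD(7)[OF hilbert_map_hproj])

lemma hproj_rot: "real_hilbert_space H \<Longrightarrow> hproj (H \<times> H) (rot v) = rot (hproj (H \<times> H) v)"
  by (simp add: hproj_Times hproj_minus)

text \<open>
  The block diagonal operator with both blocks equal to \<open>P\<close>, again on the whole type.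
\<close>

definition doubled :: "('a \<Rightarrow> 'a) \<Rightarrow> 'a \<times> 'a \<Rightarrow> 'a \<times> 'a" where
  "doubled P v = (P (fst v), P (snd v))"

lemma hilbert_map_doubled:
  assumes "real_hilbert_space K" "hilbert_map K K P"
  shows "hilbert_map (K \<times> K) (K \<times> K) (doubled P)"
proof -
  have "bounded_linear (\<lambda>v. (P (fst v), P (snd v)))"
    by (intro bounded_linear_Pair bounded_linear_compose[OF hilbert_mapD(1)[OF assms(2)]]
        bounded_linear_fst bounded_linear_snd)
  then show ?thesis
    using assms by (simp add: hilbert_map_def doubled_def[abs_def] hproj_Times)
qed

lemma adjoint_maps_doubled: "adjoint_maps P Q \<Longrightarrow> adjoint_maps (doubled P) (doubled Q)"
  by (simp add: adjoint_maps_def doubled_def inner_prod_def)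

lemma doubled_rot: "hilbert_map K K P \<Longrightarrow> doubled P (rot v) = rot (doubled P v)"
  by (simp add: doubled_def hilbert_mapD)

lemma doubled_doubled: "doubled P (doubled Q v) = doubled (\<lambda>x. P (Q x)) v"
  by (simp add: doubled_def)

text \<open>
  Uniqueness for the Sylvester equation \<open>M D + D P = 0\<close>.  Put \<open>E = D\<^sup>T D\<close>.  Since
  \<open>E P = - D\<^sup>T M D\<close> is symmetric, \<open>E\<close> commutes with \<open>P\<close> and therefore with the square root of
  \<open>P\<close>.  Hence \<open>E P\<close> is a positive operator, whereas \<open>- D\<^sup>T M D\<close> is a negative one, so
  \<open>D x \<bullet> M (D x) = 0\<close> for all \<open>x\<close> and strict positivity of \<open>M\<close> gives \<open>D = 0\<close>.
\<close>

lemma anticommuting_intertwiner_zero: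
  assumes H: "real_hilbert_space H" and K: "real_hilbert_space K"
    and P: "hilbert_map H H P" "adjoint_maps P P" "\<And>x. 0 \<le> x \<bullet> P x"
    and M: "hilbert_map K K M" "adjoint_maps M M" "\<And>y. y \<in> K \<Longrightarrow> y \<noteq> 0 \<Longrightarrow> 0 < y \<bullet> M y"
    and D: "hilbert_map H K D" "\<And>x. M (D x) = - D (P x)"
  shows "D x = 0"
proof -
  obtain Dt where Dt: "hilbert_map K H Dt" "adjoint_maps D Dt"
    using adjoint_exists[OF H K D(1)] by blast
  define E where "E = (\<lambda>x. Dt (D x))"
  have E: "hilbert_map H H E" "adjoint_maps E E"
    unfolding E_def using hilbert_map_compose[OF D(1) Dt(1)]
      adjoint_maps_compose[OF Dt(2) adjoint_maps_sym[OF Dt(2)]] by auto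
  have EP: "E (P x) = - Dt (M (D x))" for x by (simp add: E_def D(2) hilbert_mapD[OF Dt(1)])
  have "adjoint_maps (\<lambda>x. E (P x)) (\<lambda>x. P (E x))"
    by (rule adjoint_maps_compose[OF P(2) E(2)])
  moreover have "adjoint_maps (\<lambda>x. E (P x)) (\<lambda>x. E (P x))"
    by (simp add: EP adjoint_maps_def adjoint_mapsD[OF adjoint_maps_sym[OF Dt(2)]]
        adjoint_mapsD[OF M(2)] adjoint_mapsD[OF Dt(2), symmetric])
  ultimately have comm: "E (P x) = P (E x)" for x using adjoint_maps_unique by blast
  obtain R where R: "hilbert_map H H R" "adjoint_maps R R" "\<And>x. 0 \<le> x \<bullet> R x"
    "\<And>x. R (R x) = P x"
    "\<And>C x. hilbert_map H H C \<Longrightarrow> (\<And>x. C (P x) = P (C x)) \<Longrightarrow> C (R x) = R (C x)"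
    using positive_square_root[OF H P] by blast
  have ER: "E (R x) = R (E x)" for x by (rule R(5)[OF E(1) comm])
  have "x \<bullet> E (P x) = x \<bullet> R (E (R x))" by (simp only: R(4)[symmetric] ER)
  also have "\<dots> = R x \<bullet> Dt (D (R x))" by (simp add: adjoint_mapsD[OF R(2), symmetric] E_def)
  also have "\<dots> = D (R x) \<bullet> D (R x)" by (simp add: adjoint_mapsD[OF Dt(2)])
  finally have "x \<bullet> E (P x) = D (R x) \<bullet> D (R x)" .
  then have "0 \<le> x \<bullet> E (P x)" by simp
  also have "x \<bullet> E (P x) = - (D x \<bullet> M (D x))" by (simp add: EP adjoint_mapsD[OF Dt(2)])
  finally show ?thesis using M(3)[OF hilbert_mapD(2)[OF D(1)], of x] by linarith
qed

text \<open>
  The rigidity behind uniqueness: a symplectic \<open>S\<close> with \<open>S\<^sup>T (M \<oplus> M) S = P \<oplus> P\<close> is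
  automatically orthogonal, commutes with the involutions and intertwines the two diagonal operators.
  Indeed a symplectic \<open>S\<close> also satisfies \<open>S J S\<^sup>T = J\<close>, so \<open>S J (P \<oplus> P) = J (M \<oplus> M) S\<close>; applying
  this twice gives \<open>S (P \<oplus> P)\<^sup>2 = (M \<oplus> M)\<^sup>2 S\<close>.  The defect \<open>D = S (P \<oplus> P) - (M \<oplus> M) S\<close> then
  satisfies the Sylvester equation above and vanishes.  Cancelling the invertible \<open>P \<oplus> P\<close>
  yields \<open>S J = J S\<close> and \<open>S\<^sup>T S = I\<close>.
\<close>

lemma symplectic_congruence_is_orthogonal:
  assumes K: "real_hilbert_space K" and L: "real_hilbert_space L"
    and P: "hilbert_map K K P" "adjoint_maps P P" "\<And>x. 0 \<le> x \<bullet> P x"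
    and M: "hilbert_map L L M" "adjoint_maps M M" "\<And>y. y \<in> L \<Longrightarrow> y \<noteq> 0 \<Longrightarrow> 0 < y \<bullet> M y"
    and P': "hilbert_map K K P'" "\<And>x. P (P' x) = hproj K x"
    and S: "hilbert_map (K \<times> K) (L \<times> L) S" "adjoint_maps S St" "hilbert_map (L \<times> L) (K \<times> K) St"
    and S': "hilbert_map (L \<times> L) (K \<times> K) S'" "\<And>y. S (S' y) = hproj (L \<times> L) y"
    and symp: "\<And>x. St (rot (S x)) = rot (hproj (K \<times> K) x)"
    and cong: "\<And>x. St (doubled M (S x)) = doubled P x"
  shows "S (doubled P x) = doubled M (S x)" "S (rot x) = rot (S x)"
    "St (S x) = hproj (K \<times> K) x" "S (St y) = hproj (L \<times> L) y"
proof -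
  note KK = real_hilbert_space_Times[OF K K] and LL = real_hilbert_space_Times[OF L L]
  note dP = hilbert_map_doubled[OF K P(1)] and dM = hilbert_map_doubled[OF L M(1)]
  have St_rot: "St (rot y) = rot (S' y)" for y
  proof -
    have "St (rot (S (S' y))) = rot (S' y)" by (simp add: symp hproj_fixes[OF KK S'(1)])
    then have "St (hproj (L \<times> L) (rot y)) = rot (S' y)" by (simp add: S'(2) hproj_rot[OF L])
    then show ?thesis by (simp add: hilbert_mapD(3)[OF S(3)])
  qed
  have S_rot_St: "S (rot (St y)) = hproj (L \<times> L) (rot y)" for y
  proof -
    have "St y = - St (rot (rot y))" by (simp add: hilbert_mapD[OF S(3)])
    also have "\<dots> = - rot (S' (rot y))" by (simp only: St_rot)
    finally show ?thesis by (simp add: S'(2))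
  qed
  have c: "S (rot (doubled P x)) = rot (doubled M (S x))" for x
    using S_rot_St[of "doubled M (S x)"] by (simp add: cong hproj_rot[OF L] hproj_fixes[OF LL dM])
  have sq: "S (doubled P (doubled P x)) = doubled M (doubled M (S x))" for x
    using c[of "rot (doubled P x)"]
    by (simp add: c doubled_rot[OF P(1)] doubled_rot[OF M(1)] hilbert_mapD[OF S(1)])
  define D where "D = (\<lambda>x. S (doubled P x) - doubled M (S x))"
  have D: "hilbert_map (K \<times> K) (L \<times> L) D"
    unfolding D_def
    by (intro hilbert_map_diff[OF LL] hilbert_map_compose[OF dP S(1)] hilbert_map_compose[OF S(1) dM])
  have "D x = 0" for x
  proof (rule anticommuting_intertwiner_zero[OF KK LL dP adjoint_maps_doubled[OF P(2)] _
        dM adjoint_maps_doubled[OF M(2)] _ D])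
    show "0 \<le> x \<bullet> doubled P x" for x using P(3) by (simp add: doubled_def inner_prod_def)
    show "0 < y \<bullet> doubled M y" if "y \<in> L \<times> L" "y \<noteq> 0" for y
    proof -
      have nn: "0 \<le> z \<bullet> M z" if "z \<in> L" for z using M(3)[OF that] by (cases "z = 0") auto
      have "fst y \<noteq> 0 \<or> snd y \<noteq> 0" using that(2) by (auto simp: prod_eq_iff)
      then show ?thesis
        using that(1) M(3)[of "fst y"] M(3)[of "snd y"] nn[of "fst y"] nn[of "snd y"]
        by (auto simp: doubled_def inner_prod_def mem_Times_iff intro: add_pos_nonneg add_nonneg_pos)
    qed
    show "doubled M (D x) = - D (doubled P x)" for x
      by (simp add: D_def hilbert_mapD[OF dM] sq)
  qed
  then show SP: "S (doubled P x) = doubled M (S x)" for x by (simp add: D_def)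
  have onto: "doubled P (doubled P' x) = hproj (K \<times> K) x" for x
    by (simp add: doubled_doubled P'(2) hproj_Times K) (simp add: doubled_def)
  have "S (rot (hproj (K \<times> K) x)) = rot (S (hproj (K \<times> K) x))" for x
    using c[of "doubled P' x"] SP[of "doubled P' x"] by (simp add: onto)
  then show "S (rot x) = rot (S x)" for x
    by (metis S(1) K hilbert_mapD(3) hproj_rot)
  show StS: "St (S x) = hproj (K \<times> K) x" for x
  proof -
    have "St (S (doubled P (doubled P' x))) = doubled P (doubled P' x)" by (simp only: SP cong)
    then show ?thesis by (simp add: onto hilbert_mapD(3)[OF S(1)])
  qed
  have "St y = S' y" for y
    using StS[of "S' y"] by (simp add: S'(2) hilbert_mapD(3)[OF S(3)] hproj_fixes[OF KK S'(1)])
  then show "S (St y) = hproj (L \<times> L) y" for y by (simp add: S'(2))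
qed

lemma real_hilbert_space_bounded_below_image:
  fixes \<phi> :: "'a::real_inner \<Rightarrow> 'b::real_inner"
  assumes G: "real_hilbert_space G" and \<phi>: "bounded_linear \<phi>"
    and c: "c > 0" "\<And>v. v \<in> G \<Longrightarrow> norm v \<le> c * norm (\<phi> v)"
  shows "real_hilbert_space (\<phi> ` G)"
  unfolding real_hilbert_space_def
proof
  have sub: "subspace G" and com: "complete G" using G by (auto simp: real_hilbert_space_def)
  show "subspace (\<phi> ` G)" by (rule linear_subspace_image[OF bounded_linear.linear[OF \<phi>] sub])
  show "complete (\<phi> ` G)"
    by (rule complete_isometric_image[OF _ sub \<phi> _ com, of "inverse c"])
      (use c in \<open>auto simp: field_simps\<close>)
qed

text \<open>
  A complete subspace with trivial orthogonal complement is everything, because the projection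
  defect of any vector lies in that complement.
\<close>

lemma dense_complete_subspace_eq:
  assumes N: "real_hilbert_space N" and K: "real_hilbert_space K" "N \<subseteq> K"
    and orth: "\<And>v. v \<in> K \<Longrightarrow> (\<And>h. h \<in> N \<Longrightarrow> v \<bullet> h = 0) \<Longrightarrow> v = 0"
  shows "N = K"
proof -
  have "k \<in> N" if "k \<in> K" for k
  proof -
    have "k - hproj N k \<in> K"
      using that K hproj_in[OF N] by (auto simp: real_hilbert_space_def intro: subspace_diff)
    then have "k - hproj N k = 0" using orth hproj_orth[OF N] by blast
    then show ?thesis using hproj_in[OF N, of k] by simp
  qed
  then show ?thesis using K(2) by blast
qed

text \<open>
  A linear relation that preserves norms is single-valued in both directions, so if it is total and
  onto it is the graph of an orthogonal map.  Working with the relation avoids extending a densely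
  defined isometry by continuity.
\<close>

lemma isometric_relation_is_orthogonal_map:
  fixes G :: "('a::real_inner \<times> 'b::real_inner) set"
  assumes K: "real_hilbert_space K" and L: "real_hilbert_space L"
    and G: "subspace G" "\<And>x y. (x, y) \<in> G \<Longrightarrow> norm x = norm y"
    and dom: "fst ` G = K" and ran: "snd ` G = L"
  obtains W V where "hilbert_map K L W" "hilbert_map L K V" "adjoint_maps W V"
    "\<And>x. V (W x) = hproj K x" "\<And>y. W (V y) = hproj L y" "\<And>x. x \<in> K \<Longrightarrow> (x, W x) \<in> G"
    "\<And>x y. (x, y) \<in> G \<Longrightarrow> W x = y"
proof -
  have Gadd: "(x + x', y + y') \<in> G" if "(x, y) \<in> G" "(x', y') \<in> G" for x y x' y'
    using subspace_add[OF G(1) that] by simp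
  have Gscale: "(c *\<^sub>R x, c *\<^sub>R y) \<in> G" if "(x, y) \<in> G" for c x y
    using subspace_scale[OF G(1) that, of c] by simp
  have Gdiff: "(x - x', y - y') \<in> G" if "(x, y) \<in> G" "(x', y') \<in> G" for x y x' y'
    using subspace_diff[OF G(1) that] by simp
  have uniq1: "y = y'" if "(x, y) \<in> G" "(x, y') \<in> G" for x y y'
    using G(2)[OF Gdiff[OF that]] by simp
  have uniq2: "x = x'" if "(x, y) \<in> G" "(x', y) \<in> G" for x x' y
    using G(2)[OF Gdiff[OF that]] by simp
  \<comment> \<open>Polarization: norms determine inner products.\<close>
  have ip: "x \<bullet> x' = y \<bullet> y'" if "(x, y) \<in> G" "(x', y') \<in> G" for x y x' y'
    using G(2)[OF Gadd[OF that]] G(2)[OF that(1)] G(2)[OF that(2)]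
    by (simp add: norm_eq inner_add inner_commute)
  have "\<exists>y. (hproj K x, y) \<in> G" for x using hproj_in[OF K, of x] dom by force
  then obtain W where W: "\<And>x. (hproj K x, W x) \<in> G" by metis
  have "\<exists>x. (x, hproj L y) \<in> G" for y using hproj_in[OF L, of y] ran by force
  then obtain V where V: "\<And>y. (V y, hproj L y) \<in> G" by metis
  have WL: "W x \<in> L" for x using W ran by force
  have VK: "V x \<in> K" for x using V dom by force
  have Weq: "W x = y" if "(x, y) \<in> G" for x y
  proof -
    have "x \<in> K" using that dom by force
    then show ?thesis using W[of x] uniq1 that by (simp add: hproj_id[OF K])
  qed
  have Veq: "V y = x" if "(x, y) \<in> G" for x y
  proof -
    have "y \<in> L" using that ran by force
    then show ?thesis using V[of y] uniq2 that by (simp add: hproj_id[OF L])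
  qed
  note pK = hilbert_mapD[OF hilbert_map_hproj[OF K]] and pL = hilbert_mapD[OF hilbert_map_hproj[OF L]]
  show thesis
  proof (rule that[of W V])
    have "bounded_linear W"
    proof (rule bounded_linear_intro[of _ 1])
      show "W (x + y) = W x + W y" for x y
        using uniq1[OF W] Gadd[OF W W] by (simp add: pK)
      show "W (c *\<^sub>R x) = c *\<^sub>R W x" for c x
        using uniq1[OF W] Gscale[OF W] by (simp add: pK)
      show "norm (W x) \<le> norm x * 1" for x
        using G(2)[OF W] norm_hproj_le[OF K] by simp
    qed
    moreover have "W (hproj K x) = W x" for x by (rule Weq[OF W])
    ultimately show "hilbert_map K L W" using WL by (simp add: hilbert_map_def)
    have "bounded_linear V"
    proof (rule bounded_linear_intro[of _ 1])
      show "V (x + y) = V x + V y" for x y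
        using uniq2[OF V] Gadd[OF V V] by (simp add: pL)
      show "V (c *\<^sub>R x) = c *\<^sub>R V x" for c x
        using uniq2[OF V] Gscale[OF V] by (simp add: pL)
      show "norm (V x) \<le> norm x * 1" for x
        using G(2)[OF V] norm_hproj_le[OF L] by simp
    qed
    moreover have "V (hproj L x) = V x" for x by (rule Veq[OF V])
    ultimately show "hilbert_map L K V" using VK by (simp add: hilbert_map_def)
    show "V (W x) = hproj K x" for x by (rule Veq[OF W])
    show "W (V y) = hproj L y" for y by (rule Weq[OF V])
    show "adjoint_maps W V"
      unfolding adjoint_maps_def
      by (metis K L V VK W WL hproj_inner inner_commute ip)
    show "(x, W x) \<in> G" if "x \<in> K" for x using W[of x] that by (simp add: hproj_id[OF K])
    show "W x = y" if "(x, y) \<in> G" for x y by (rule Weq[OF that])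
  qed
qed

section \<open>From unitary to orthogonal equivalence\<close>

lemma limit_in_closure:
  fixes x :: "'a::real_normed_vector"
  assumes "f \<longlonglongrightarrow> x" "\<And>n. f n \<in> S"
  shows "x \<in> closure S"
  unfolding closure_sequential by (rule exI[of _ f]) (use assms in blast)

lemma subspace_closure:
  fixes S :: "'a::real_normed_vector set"
  assumes S: "subspace S"
  shows "subspace (closure S)"
  unfolding subspace_def
proof (intro conjI ballI allI)
  show "0 \<in> closure S" using subspace_0[OF S] closure_subset by blast
next
  fix x y assume "x \<in> closure S" "y \<in> closure S"
  then obtain f g where "\<And>n. f n \<in> S" "f \<longlonglongrightarrow> x" "\<And>n. g n \<in> S" "g \<longlonglongrightarrow> y"
    unfolding closure_sequential by blast
  then show "x + y \<in> closure S"
    by (intro limit_in_closure[OF tendsto_add[of f _ _ g]] subspace_add[OF S])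
next
  fix c :: real and x assume "x \<in> closure S"
  then obtain f where "\<And>n. f n \<in> S" "f \<longlonglongrightarrow> x" unfolding closure_sequential by blast
  then show "c *\<^sub>R x \<in> closure S"
    by (intro limit_in_closure[OF tendsto_scaleR[OF tendsto_const]] subspace_scale[OF S])
qed

lemma hilbert_map_inl:
  assumes "real_hilbert_space K" "real_hilbert_space L"
  shows "hilbert_map K (K \<times> L) (\<lambda>k. (hproj K k, 0))"
  using assms
  by (auto simp: hilbert_map_def hproj_in hproj_hproj real_hilbert_space_def subspace_0
      intro!: bounded_linear_Pair bounded_linear_hproj bounded_linear_zero)

lemma hilbert_map_fst:
  assumes "real_hilbert_space K" "hilbert_map H (K \<times> L) S"
  shows "hilbert_map H K (\<lambda>x. fst (S x))"
  using assms hilbert_mapD(2)[OF assms(2)]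
  by (auto simp: hilbert_map_def mem_Times_iff intro: bounded_linear_fst_comp)

lemma hilbert_map_snd:
  assumes "real_hilbert_space K" "hilbert_map H (K \<times> L) S"
  shows "hilbert_map H L (\<lambda>x. snd (S x))"
  using assms hilbert_mapD(2)[OF assms(2)]
  by (auto simp: hilbert_map_def mem_Times_iff intro: bounded_linear_snd_comp)

text \<open>
  Read \<open>K \<times> K\<close> and \<open>L \<times> L\<close> as complexifications with \<open>rot\<close> as multiplication by the imaginary
  unit.  Then \<open>S = X + i Y\<close> is a unitary with real operators \<open>X, Y\<close> that both intertwine \<open>P\<close>
  and \<open>M\<close>, and a real orthogonal intertwiner is wanted.  On the orthogonal complement of \<open>ker X\<close>
  the isometric factor of the polar decomposition \<open>X = V R\<close>, \<open>R = (X\<^sup>T X)\<^sup>1\<^sup>/\<^sup>2\<close>, intertwines.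
  What it misses is \<open>ker X\<close> in the domain and \<open>ker X\<^sup>T\<close> in the range, and since \<open>S\<close> is
  unitary, \<open>Y\<close> maps the first of these isometrically onto the second.  Both pieces are packed into
  the relation \<open>{(R z + e, X z + Y e) | e \<in> ker X}\<close>, whose closure is the graph of an orthogonal
  map.
\<close>

lemma unitary_equivalence_imp_orthogonal_equivalence:
  assumes K: "real_hilbert_space K" and L: "real_hilbert_space L"
    and P: "hilbert_map K K P" "adjoint_maps P P"
    and M: "hilbert_map L L M" "adjoint_maps M M"
    and S: "hilbert_map (K \<times> K) (L \<times> L) S" "adjoint_maps S St" "hilbert_map (L \<times> L) (K \<times> K) St"
    and SP: "\<And>x. S (doubled P x) = doubled M (S x)" and S_rot: "\<And>x. S (rot x) = rot (S x)"
    and inv: "\<And>x. St (S x) = hproj (K \<times> K) x" "\<And>y. S (St y) = hproj (L \<times> L) y"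
  obtains W V where "hilbert_map K L W" "hilbert_map L K V" "adjoint_maps W V"
    "\<And>x. V (W x) = hproj K x" "\<And>y. W (V y) = hproj L y" "\<And>x. M (W x) = W (P x)"
proof -
  note KK = real_hilbert_space_Times[OF K K] and LL = real_hilbert_space_Times[OF L L]
  have subK: "subspace K" and subL: "subspace L"
    using K L by (auto simp: real_hilbert_space_def)
  have S_proj: "S (hproj K k, 0) = S (k, 0)" for k
    using hilbert_mapD(3)[OF S(1), of "(k, 0)"] by (simp add: hproj_Times K hproj_0)
  have St_proj: "St (hproj L k, 0) = St (k, 0)" for k
    using hilbert_mapD(3)[OF S(3), of "(k, 0)"] by (simp add: hproj_Times L hproj_0)
  define X where "X = (\<lambda>k. fst (S (k, 0)))"
  define Y where "Y = (\<lambda>k. snd (S (k, 0)))"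
  define Xt where "Xt = (\<lambda>h. fst (St (h, 0)))"
  have S0: "S (k, 0) = (X k, Y k)" for k by (simp add: X_def Y_def)
  have S1: "S (0, k) = (- Y k, X k)" for k
    using S_rot[of "(k, 0)"] by (simp add: S0)
  have X: "hilbert_map K L X" and Y: "hilbert_map K L Y"
    using hilbert_map_fst[OF L hilbert_map_compose[OF hilbert_map_inl[OF K K] S(1)]]
      hilbert_map_snd[OF L hilbert_map_compose[OF hilbert_map_inl[OF K K] S(1)]]
    by (simp_all add: S_proj X_def Y_def)
  have Xt: "hilbert_map L K Xt"
    using hilbert_map_fst[OF K hilbert_map_compose[OF hilbert_map_inl[OF L L] S(3)]]
    by (simp add: St_proj Xt_def)
  have XXt: "adjoint_maps X Xt"
    unfolding adjoint_maps_def
  proof (intro allI)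
    fix k h
    have "X k \<bullet> h = S (k, 0) \<bullet> (h, 0)" by (simp add: S0)
    also have "\<dots> = (k, 0) \<bullet> St (h, 0)" by (rule adjoint_mapsD[OF S(2)])
    finally show "X k \<bullet> h = k \<bullet> Xt h" by (simp add: Xt_def inner_prod_def)
  qed
  have XP: "X (P k) = M (X k)" and YP: "Y (P k) = M (Y k)" for k
    using SP[of "(k, 0)"] by (simp_all add: doubled_def S0 hilbert_mapD[OF P(1)])
  have S_inner: "S u \<bullet> S v = u \<bullet> hproj (K \<times> K) v" for u v
    by (simp add: adjoint_mapsD[OF S(2)] inv)
  \<comment> \<open>Compare the images of \<open>(z, 0)\<close> and \<open>(0, e)\<close>, which are orthogonal.\<close>
  have orth: "X z \<bullet> Y e = 0" if "X e = 0" for z e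
    using S_inner[of "(z, 0)" "(0, e)"] that by (simp add: S0 S1 hproj_Times K hproj_0)
  have norm_Y: "norm (Y e) = norm e" if "e \<in> K" "X e = 0" for e
    using S_inner[of "(e, 0)" "(e, 0)"] that
    by (simp add: S0 hproj_Times K hproj_0 hproj_id norm_eq)
  have XtX: "hilbert_map K K (\<lambda>k. Xt (X k))" "adjoint_maps (\<lambda>k. Xt (X k)) (\<lambda>k. Xt (X k))"
    using hilbert_map_compose[OF X Xt] adjoint_maps_compose[OF XXt adjoint_maps_sym[OF XXt]] by auto
  have "0 \<le> k \<bullet> Xt (X k)" for k by (simp add: adjoint_mapsD[OF XXt, symmetric])
  then obtain R where R: "hilbert_map K K R" "adjoint_maps R R" "\<And>x. 0 \<le> x \<bullet> R x"
    "\<And>x. R (R x) = Xt (X x)"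
    "\<And>C x. hilbert_map K K C \<Longrightarrow> (\<And>x. C (Xt (X x)) = Xt (X (C x))) \<Longrightarrow> C (R x) = R (C x)"
    using positive_square_root[OF K XtX] by blast
  have "adjoint_maps (\<lambda>k. X (P k)) (\<lambda>h. P (Xt h))" by (rule adjoint_maps_compose[OF P(2) XXt])
  moreover have "adjoint_maps (\<lambda>k. X (P k)) (\<lambda>h. Xt (M h))"
    unfolding XP by (rule adjoint_maps_compose[OF XXt M(2)])
  ultimately have PXt: "P (Xt h) = Xt (M h)" for h by (rule adjoint_maps_unique)
  have PR: "P (R k) = R (P k)" for k by (rule R(5)[OF P(1)]) (simp add: PXt XP)
  have norm_R: "norm (R k) = norm (X k)" for k
    by (simp add: norm_eq adjoint_mapsD[OF R(2)] R(4) adjoint_mapsD[OF XXt])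
  note lin = hilbert_mapD(5-9)[OF X] hilbert_mapD(5-9)[OF Y] hilbert_mapD(5-9)[OF R(1)]
    hilbert_mapD(5-9)[OF P(1)] hilbert_mapD(5-9)[OF M(1)]
  define G0 where "G0 = {(R z + e, X z + Y e) | z e. e \<in> K \<and> X e = 0}"
  have G0I: "(R z + e, X z + Y e) \<in> G0" if "e \<in> K" "X e = 0" for z e
    using that by (auto simp: G0_def)
  have G0_norm: "norm (fst v) = norm (snd v)" if v: "v \<in> G0" for v
  proof -
    obtain z e where e: "e \<in> K" "X e = 0" and v: "v = (R z + e, X z + Y e)"
      using v by (auto simp: G0_def)
    have "R e = 0" using norm_R[of e] e by simp
    then have "R z \<bullet> e = 0" by (simp add: adjoint_mapsD[OF R(2)])
    then show ?thesis
      using orth[OF e(2), of z] norm_R[of z] norm_Y[OF e]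
      by (simp add: v norm_eq inner_add inner_commute)
  qed
  have G0_sub: "subspace G0"
    unfolding subspace_def
  proof (intro conjI ballI allI)
    show "0 \<in> G0" using G0I[of 0 0] subspace_0[OF subK] by (simp add: lin zero_prod_def)
    fix u v assume "u \<in> G0" "v \<in> G0"
    then obtain z e z' e' where "e \<in> K" "X e = 0" "u = (R z + e, X z + Y e)"
      "e' \<in> K" "X e' = 0" "v = (R z' + e', X z' + Y e')"
      by (auto simp: G0_def)
    then show "u + v \<in> G0"
      using G0I[of "e + e'" "z + z'"] subspace_add[OF subK] by (simp add: lin algebra_simps)
  next
    fix c u assume "u \<in> G0"
    then obtain z e where "e \<in> K" "X e = 0" "u = (R z + e, X z + Y e)"
      by (auto simp: G0_def)
    then show "c *\<^sub>R u \<in> G0"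
      using G0I[of "c *\<^sub>R e" "c *\<^sub>R z"] subspace_scale[OF subK] by (simp add: lin algebra_simps)
  qed
  have G0_KL: "G0 \<subseteq> K \<times> L"
    using hilbert_mapD(2)[OF R(1)] hilbert_mapD(2)[OF X] hilbert_mapD(2)[OF Y]
    by (auto simp: G0_def intro: subspace_add[OF subK] subspace_add[OF subL])
  have G0_PM: "(P (fst v), M (snd v)) \<in> G0" if v0: "v \<in> G0" for v
  proof -
    obtain z e where e: "e \<in> K" "X e = 0" and v: "v = (R z + e, X z + Y e)"
      using v0 by (auto simp: G0_def)
    have "P e \<in> K" "X (P e) = 0" using e hilbert_mapD(2)[OF P(1)] by (simp_all add: XP lin)
    then show ?thesis using G0I[of "P e" "P z"] by (simp add: v lin PR XP YP)
  qed
  define G where "G = closure G0"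
  have G_sub: "subspace G" unfolding G_def by (rule subspace_closure[OF G0_sub])
  have G_norm: "norm x = norm y" if "(x, y) \<in> G" for x y
  proof -
    have "closed {v :: 'a \<times> 'b. norm (fst v) = norm (snd v)}"
      by (intro closed_Collect_eq continuous_intros)
    then have "G \<subseteq> {v. norm (fst v) = norm (snd v)}"
      unfolding G_def using G0_norm by (intro closure_minimal) auto
    then show ?thesis using that by auto
  qed
  have G_KL: "G \<subseteq> K \<times> L"
    unfolding G_def using G0_KL real_hilbert_space_Times[OF K L]
    by (intro closure_minimal complete_imp_closed) (auto simp: real_hilbert_space_def)
  have "complete G"
    using complete_closed_subset[OF _ G_KL] real_hilbert_space_Times[OF K L]
    by (simp add: real_hilbert_space_def G_def)
  then have G: "real_hilbert_space G" using G_sub by (simp add: real_hilbert_space_def)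
  have G_PM: "(P x, M y) \<in> G" if "(x, y) \<in> G" for x y
  proof -
    obtain s where s: "\<And>n. s n \<in> G0" "s \<longlonglongrightarrow> (x, y)"
      using \<open>(x, y) \<in> G\<close> unfolding G_def closure_sequential by blast
    have "(\<lambda>n. (P (fst (s n)), M (snd (s n)))) \<longlonglongrightarrow> (P x, M y)"
      using tendsto_fst[OF s(2)] tendsto_snd[OF s(2)]
      by (intro tendsto_Pair bounded_linear.tendsto[OF hilbert_mapD(1)[OF P(1)]]
          bounded_linear.tendsto[OF hilbert_mapD(1)[OF M(1)]]) simp_all
    then show ?thesis unfolding G_def by (rule limit_in_closure) (rule G0_PM[OF s(1)])
  qed
  have norm_G: "norm v \<le> 2 * norm (fst v)" "norm v \<le> 2 * norm (snd v)" if "v \<in> G" for v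
    using norm_Pair_le[of "fst v" "snd v"] G_norm[of "fst v" "snd v"] that by auto
  have dom: "fst ` G = K"
  proof (rule dense_complete_subspace_eq[OF _ K])
    show "real_hilbert_space (fst ` G)"
      by (rule real_hilbert_space_bounded_below_image[OF G bounded_linear_fst, of 2])
        (use norm_G in auto)
    show "fst ` G \<subseteq> K" using G_KL by auto
    \<comment> \<open>A vector orthogonal to the range of \<open>R\<close> lies in \<open>ker R = ker X\<close>, hence in the domain itself.\<close>
    fix v assume v: "v \<in> K" "\<And>h. h \<in> fst ` G \<Longrightarrow> v \<bullet> h = 0"
    have mem: "R z + e \<in> fst ` G" if "e \<in> K" "X e = 0" for z e
      using G0I[OF that] closure_subset[of G0] unfolding G_def by force
    have "R (R v) \<in> fst ` G" using mem[of 0 "R v"] subspace_0[OF subK] by (simp add: lin)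
    then have "R v \<bullet> R v = 0" using v(2) by (simp add: adjoint_mapsD[OF R(2)])
    then have "X v = 0" using norm_R[of v] by simp
    then have "v \<in> fst ` G" using mem[of v 0] v(1) by (simp add: lin)
    then have "v \<bullet> v = 0" by (rule v(2))
    then show "v = 0" by simp
  qed
  have ran: "snd ` G = L"
  proof (rule dense_complete_subspace_eq[OF _ L])
    show "real_hilbert_space (snd ` G)"
      by (rule real_hilbert_space_bounded_below_image[OF G bounded_linear_snd, of 2])
        (use norm_G in auto)
    show "snd ` G \<subseteq> L" using G_KL by auto
    fix v assume v: "v \<in> L" "\<And>h. h \<in> snd ` G \<Longrightarrow> v \<bullet> h = 0"
    have mem: "X z + Y e \<in> snd ` G" if "e \<in> K" "X e = 0" for z e
      using G0I[OF that] closure_subset[of G0] unfolding G_def by force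
    have "X (Xt v) \<in> snd ` G" using mem[of 0 "Xt v"] subspace_0[OF subK] by (simp add: lin)
    then have "v \<bullet> X (Xt v) = 0" by (rule v(2))
    then have Xtv: "Xt v = 0" by (simp add: adjoint_mapsD[OF adjoint_maps_sym[OF XXt], symmetric])
    \<comment> \<open>Now \<open>X\<^sup>T v = 0\<close>, so \<open>S\<^sup>T (v, 0)\<close> is purely imaginary; its imaginary part, up to sign,
      is an element of \<open>ker X\<close> that \<open>Y\<close> maps to \<open>v\<close>.\<close>
    define e where "e = - snd (St (v, 0))"
    have "St (v, 0) = (0, - e)" using Xtv by (simp add: Xt_def e_def prod_eq_iff)
    then have "S (0, - e) = (v, 0)"
      using inv(2)[of "(v, 0)"] v(1) by (simp add: hproj_Times L hproj_0 hproj_id)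
    then have "Y e = v" "X e = 0" by (simp_all add: S1 lin)
    moreover have "e \<in> K"
      using hilbert_mapD(2)[OF S(3), of "(v, 0)"] subspace_neg[OF subK]
      by (simp add: e_def mem_Times_iff)
    ultimately have "v \<in> snd ` G" using mem[of e 0] by (simp add: lin)
    then have "v \<bullet> v = 0" by (rule v(2))
    then show "v = 0" by simp
  qed
  obtain W V where WV: "hilbert_map K L W" "hilbert_map L K V" "adjoint_maps W V"
    "\<And>x. V (W x) = hproj K x" "\<And>y. W (V y) = hproj L y" "\<And>x. x \<in> K \<Longrightarrow> (x, W x) \<in> G"
    "\<And>x y. (x, y) \<in> G \<Longrightarrow> W x = y"
    using isometric_relation_is_orthogonal_map[OF K L G_sub G_norm dom ran] by blast
  have "M (W x) = W (P x)" for x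
  proof -
    have "(P (hproj K x), M (W (hproj K x))) \<in> G" by (intro G_PM WV(6) hproj_in[OF K])
    then have "(P x, M (W x)) \<in> G" by (simp add: hilbert_mapD(3)[OF P(1)] hilbert_mapD(3)[OF WV(1)])
    then show ?thesis using WV(7) by simp
  qed
  then show thesis by (rule that[OF WV(1-5)])
qed

section \<open>Uniqueness of the factorization\<close>

lemma bounded_op_hproj:
  assumes H: "real_hilbert_space H" and f: "bounded_op H K f"
  shows "hilbert_map H K (\<lambda>x. f (hproj H x))"
proof -
  obtain C where C: "\<And>x. x \<in> H \<Longrightarrow> norm (f x) \<le> C * norm x"
    using f unfolding bounded_op_def by blast
  note p = hproj_in[OF H] hilbert_mapD[OF hilbert_map_hproj[OF H]]
  have "bounded_linear (\<lambda>x. f (hproj H x))"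
  proof (rule bounded_linear_intro)
    show "f (hproj H (x + y)) = f (hproj H x) + f (hproj H y)" for x y
      using f p by (simp add: bounded_op_def)
    show "f (hproj H (c *\<^sub>R x)) = c *\<^sub>R f (hproj H x)" for c x
      using f p by (simp add: bounded_op_def)
    show "norm (f (hproj H x)) \<le> norm x * \<bar>C\<bar>" for x
    proof -
      have "norm (f (hproj H x)) \<le> C * norm (hproj H x)" by (intro C p)
      also have "\<dots> \<le> \<bar>C\<bar> * norm x" by (intro mult_mono norm_hproj_le[OF H]) auto
      finally show ?thesis by (simp add: mult.commute)
    qed
  qed
  then show ?thesis
    using f hproj_in[OF H] by (auto simp: hilbert_map_def hproj_hproj[OF H] bounded_op_def)
qed

lemma bounded_op_restrict:
  assumes f: "hilbert_map H K f" and sub: "subspace H"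
  shows "bounded_op H K (restrict f H)"
proof -
  obtain C where "0 < C" "\<And>x. norm (f x) \<le> C * norm x" using hilbert_map_bound[OF f] by blast
  then show ?thesis
    using hilbert_mapD[OF f] subspace_add[OF sub] subspace_scale[OF sub]
    by (auto simp: bounded_op_def intro!: exI[of _ C])
qed

lemma transpose_op_restrict:
  assumes H: "subspace H" and K: "subspace K"
    and g: "hilbert_map K H g" "adjoint_maps f g" and f: "\<And>x. x \<in> H \<Longrightarrow> L x = f x"
  shows "transpose_op H K L = restrict g K"
  by (rule transpose_op_eqI[OF H bounded_op_restrict[OF g(1) K]])
    (simp add: f adjoint_mapsD[OF g(2)])

text \<open>
  The condition \<open>transpose_op H H P = P\<close> mentions a definite description.  It is informative because
  bounded operators between Hilbert spaces do have adjoints.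
\<close>

lemma positive_op_hproj:
  assumes H: "real_hilbert_space H" and P: "positive_op H P"
  shows "hilbert_map H H (\<lambda>x. P (hproj H x))"
    "adjoint_maps (\<lambda>x. P (hproj H x)) (\<lambda>x. P (hproj H x))"
    "0 \<le> x \<bullet> P (hproj H x)"
proof -
  have sub: "subspace H" using H by (simp add: real_hilbert_space_def)
  show hm: "hilbert_map H H (\<lambda>x. P (hproj H x))"
    using P by (intro bounded_op_hproj[OF H]) (simp add: positive_op_def)
  obtain Q where Q: "hilbert_map H H Q" "adjoint_maps (\<lambda>x. P (hproj H x)) Q"
    using adjoint_exists[OF H H hm] by blast
  have "transpose_op H H P = restrict Q H"
    by (rule transpose_op_restrict[OF sub sub Q]) (simp add: hproj_id[OF H])
  then have "P = restrict Q H" using P by (simp add: positive_op_def)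
  then have "P (hproj H x) = Q x" for x by (metis H hilbert_mapD(3)[OF Q(1)] hproj_in restrict_apply')
  then show "adjoint_maps (\<lambda>x. P (hproj H x)) (\<lambda>x. P (hproj H x))" using Q(2) by simp
  have "x \<bullet> P (hproj H x) = hproj H x \<bullet> P (hproj H x)"
    by (rule hproj_inner[OF H hilbert_mapD(2)[OF hm], symmetric])
  then show "0 \<le> x \<bullet> P (hproj H x)" using P hproj_in[OF H, of x] by (simp add: positive_op_def)
qed

lemma positive_op_restrict:
  assumes H: "real_hilbert_space H"
    and P: "hilbert_map H H P" "adjoint_maps P P" "\<And>x. 0 \<le> x \<bullet> P x"
  shows "positive_op H (restrict P H)"
proof -
  have sub: "subspace H" using H by (simp add: real_hilbert_space_def)
  then show ?thesis
    using P(3) bounded_op_restrict[OF P(1) sub] transpose_op_restrict[OF sub sub P(1,2)]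
    by (simp add: positive_op_def)
qed

lemma invertible_op_hproj:
  assumes H: "real_hilbert_space H" and K: "real_hilbert_space K" and f: "invertible_op H K f"
  obtains g where "hilbert_map K H g" "\<And>x. g (f (hproj H x)) = hproj H x"
    "\<And>y. f (hproj H (g y)) = hproj K y"
proof -
  obtain B where B: "bounded_op K H B" "compose H B f = id_op H" "compose K f B = id_op K"
    using f by (auto simp: invertible_op_def)
  have fK: "f x \<in> K" if "x \<in> H" for x
    using f that by (auto simp: invertible_op_def bounded_op_def)
  have BH: "B y \<in> H" if "y \<in> K" for y using B(1) that by (auto simp: bounded_op_def)
  have Bf: "B (f x) = x" if "x \<in> H" for x
    using fun_cong[OF B(2), of x] that by (simp add: compose_def id_op_def)
  have fB: "f (B y) = y" if "y \<in> K" for y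
    using fun_cong[OF B(3), of y] that by (simp add: compose_def id_op_def)
  show thesis
    by (rule that[OF bounded_op_hproj[OF K B(1)]])
      (simp_all add: hproj_in[OF H] hproj_in[OF K] hproj_id[OF K] hproj_id[OF H] fK BH Bf fB)
qed

lemma invertible_op_restrict:
  assumes H: "real_hilbert_space H" and K: "real_hilbert_space K"
    and f: "hilbert_map H K f" and g: "hilbert_map K H g"
    and inv: "\<And>x. x \<in> H \<Longrightarrow> g (f x) = x" "\<And>y. y \<in> K \<Longrightarrow> f (g y) = y"
  shows "invertible_op H K (restrict f H)"
proof -
  have sub: "subspace H" "subspace K" using H K by (simp_all add: real_hilbert_space_def)
  have "compose H (restrict g K) (restrict f H) = id_op H"
    "compose K (restrict f H) (restrict g K) = id_op K"
    by (auto simp: compose_def id_op_def fun_eq_iff restrict_def inv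
        hilbert_mapD(2)[OF f] hilbert_mapD(2)[OF g])
  then show ?thesis
    unfolding invertible_op_def
    using bounded_op_restrict[OF f sub(1)] bounded_op_restrict[OF g sub(2)] by blast
qed

text \<open>
  A factorization, restated with maps on the whole types and with an explicit adjoint \<open>St\<close> and
  inverse \<open>S'\<close> of the symplectic transformation \<open>S\<close>.
\<close>

lemma williamson_factorization_hproj:
  assumes H: "real_hilbert_space H" and K: "real_hilbert_space K"
    and P: "positive_op K P" and fac: "williamson_factorization H A K P L"
  obtains S St S' where "hilbert_map (H \<times> H) (K \<times> K) S" "hilbert_map (K \<times> K) (H \<times> H) St"
    "adjoint_maps S St" "hilbert_map (K \<times> K) (H \<times> H) S'"
    "\<And>x. S' (S x) = hproj (H \<times> H) x" "\<And>y. S (S' y) = hproj (K \<times> K) y"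
    "\<And>x. St (rot (S x)) = rot (hproj (H \<times> H) x)"
    "\<And>x. St (doubled (\<lambda>k. P (hproj K k)) (S x)) = A (hproj (H \<times> H) x)"
proof -
  note HH = real_hilbert_space_Times[OF H H] and KK = real_hilbert_space_Times[OF K K]
  have sub: "subspace (H \<times> H)" "subspace (K \<times> K)" "subspace K"
    using HH KK K by (simp_all add: real_hilbert_space_def)
  have inv: "invertible_op (H \<times> H) (K \<times> K) L"
    and symp: "compose (H \<times> H) (transpose_op (H \<times> H) (K \<times> K) L)
       (compose (H \<times> H) (involution_op K) L) = involution_op H"
    and AL: "A = compose (H \<times> H) (transpose_op (H \<times> H) (K \<times> K) L) (compose (H \<times> H) (diag_op K P) L)"
    using fac by (simp_all add: williamson_factorization_def symplectic_op_def)
  have L: "bounded_op (H \<times> H) (K \<times> K) L" using inv by (simp add: invertible_op_def)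
  define S where "S = (\<lambda>x. L (hproj (H \<times> H) x))"
  have S: "hilbert_map (H \<times> H) (K \<times> K) S" unfolding S_def by (rule bounded_op_hproj[OF HH L])
  obtain S' where S': "hilbert_map (K \<times> K) (H \<times> H) S'" "\<And>x. S' (S x) = hproj (H \<times> H) x"
    "\<And>y. S (S' y) = hproj (K \<times> K) y"
    using invertible_op_hproj[OF HH KK inv] unfolding S_def by blast
  obtain St where St: "hilbert_map (K \<times> K) (H \<times> H) St" "adjoint_maps S St"
    using adjoint_exists[OF HH KK S] by blast
  have tr: "transpose_op (H \<times> H) (K \<times> K) L = restrict St (K \<times> K)"
    by (rule transpose_op_restrict[OF sub(1,2) St]) (simp add: S_def hproj_id[OF HH])
  have 1: "St (rot (S x)) = rot (hproj (H \<times> H) x)" for x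
  proof -
    define z where "z = hproj (H \<times> H) x"
    have z: "z \<in> H \<times> H" unfolding z_def by (rule hproj_in[OF HH])
    have Sz: "S x = L z" by (simp add: S_def z_def)
    then have Lz: "L z \<in> K \<times> K" using hilbert_mapD(2)[OF S, of x] by simp
    then have "rot (L z) \<in> K \<times> K" by (auto simp: mem_Times_iff subspace_neg[OF sub(3)])
    moreover have "involution_op K (L z) = rot (L z)"
      using Lz by (auto simp: involution_op_def rot_def split: prod.splits)
    moreover have "involution_op H z = rot z"
      using z by (auto simp: involution_op_def rot_def split: prod.splits)
    ultimately show ?thesis
      using fun_cong[OF symp, of z] z by (simp add: compose_def tr Sz z_def)
  qed
  have 2: "St (doubled (\<lambda>k. P (hproj K k)) (S x)) = A (hproj (H \<times> H) x)" for x
  proof -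
    define z where "z = hproj (H \<times> H) x"
    have z: "z \<in> H \<times> H" unfolding z_def by (rule hproj_in[OF HH])
    have Sz: "S x = L z" by (simp add: S_def z_def)
    then have Lz: "L z \<in> K \<times> K" using hilbert_mapD(2)[OF S, of x] by simp
    have "doubled (\<lambda>k. P (hproj K k)) (L z) \<in> K \<times> K"
      using hilbert_mapD(2)[OF positive_op_hproj(1)[OF K P]] by (simp add: doubled_def)
    moreover have "diag_op K P (L z) = doubled (\<lambda>k. P (hproj K k)) (L z)"
      using Lz by (auto simp: diag_op_def doubled_def hproj_id[OF K] split: prod.splits)
    ultimately show ?thesis
      using fun_cong[OF AL, of z] z by (simp add: compose_def tr Sz z_def)
  qed
  show thesis by (rule that[OF S St S' 1 2])
qed

lemma williamson_factorization_restrict: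
  assumes H: "real_hilbert_space H" and K: "real_hilbert_space K"
    and P: "hilbert_map K K P"
    and S: "hilbert_map (H \<times> H) (K \<times> K) S" "hilbert_map (K \<times> K) (H \<times> H) St" "adjoint_maps S St"
    and S': "hilbert_map (K \<times> K) (H \<times> H) S'" "\<And>x. x \<in> H \<times> H \<Longrightarrow> S' (S x) = x"
      "\<And>y. y \<in> K \<times> K \<Longrightarrow> S (S' y) = y"
    and symp: "\<And>x. x \<in> H \<times> H \<Longrightarrow> St (rot (S x)) = rot x"
    and A: "A \<in> extensional (H \<times> H)" "\<And>x. x \<in> H \<times> H \<Longrightarrow> St (doubled P (S x)) = A x"
  shows "williamson_factorization H A K (restrict P K) (restrict S (H \<times> H))"
proof -
  note HH = real_hilbert_space_Times[OF H H] and KK = real_hilbert_space_Times[OF K K]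
  have sub: "subspace (H \<times> H)" "subspace (K \<times> K)" "subspace K"
    using HH KK K by (simp_all add: real_hilbert_space_def)
  have tr: "transpose_op (H \<times> H) (K \<times> K) (restrict S (H \<times> H)) = restrict St (K \<times> K)"
    by (rule transpose_op_restrict[OF sub(1,2) S(2,3)]) simp
  have SK: "S z \<in> K \<times> K" for z by (rule hilbert_mapD(2)[OF S(1)])
  have rotK: "rot (S z) \<in> K \<times> K" for z
    using SK[of z] by (auto simp: mem_Times_iff subspace_neg[OF sub(3)])
  have invK: "involution_op K (S z) = rot (S z)" for z
    using SK[of z] by (auto simp: involution_op_def rot_def split: prod.splits)
  have invH: "involution_op H z = rot z" if "z \<in> H \<times> H" for z
    using that by (auto simp: involution_op_def rot_def split: prod.splits)
  have diagK: "diag_op K (restrict P K) (S z) = doubled P (S z)" for z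
    using SK[of z] by (auto simp: diag_op_def doubled_def split: prod.splits)
  have dK: "doubled P z \<in> K \<times> K" for z
    using hilbert_mapD(2)[OF P] by (simp add: doubled_def)
  have inv: "invertible_op (H \<times> H) (K \<times> K) (restrict S (H \<times> H))"
    by (rule invertible_op_restrict[OF HH KK S(1) S'])
  have 1: "compose (H \<times> H) (transpose_op (H \<times> H) (K \<times> K) (restrict S (H \<times> H)))
       (compose (H \<times> H) (involution_op K) (restrict S (H \<times> H))) = involution_op H"
  proof (rule extensionalityI[of _ "H \<times> H"])
    show "involution_op H \<in> extensional (H \<times> H)" by (simp add: involution_op_def)
    fix z assume "z \<in> H \<times> H"
    then show "compose (H \<times> H) (transpose_op (H \<times> H) (K \<times> K) (restrict S (H \<times> H)))
       (compose (H \<times> H) (involution_op K) (restrict S (H \<times> H))) z = involution_op H z"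
      by (simp add: compose_def tr invK invH rotK symp)
  qed (rule compose_extensional)
  have 2: "A = compose (H \<times> H) (transpose_op (H \<times> H) (K \<times> K) (restrict S (H \<times> H)))
      (compose (H \<times> H) (diag_op K (restrict P K)) (restrict S (H \<times> H)))"
  proof (rule extensionalityI[OF A(1) compose_extensional])
    fix z assume "z \<in> H \<times> H"
    then show "A z = compose (H \<times> H) (transpose_op (H \<times> H) (K \<times> K) (restrict S (H \<times> H)))
      (compose (H \<times> H) (diag_op K (restrict P K)) (restrict S (H \<times> H))) z"
      by (simp add: compose_def tr diagK dK A(2))
  qed
  show ?thesis using inv 1 2 by (simp add: williamson_factorization_def symplectic_op_def)
qed

text \<open>
  Given two factorizations with symplectic parts \<open>L\<close> and \<open>L'\<close>, the map \<open>S = L' L\<inverse>\<close> is symplectic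
  with \<open>S\<^sup>T (M \<oplus> M) S = P \<oplus> P\<close>.  By rigidity it is orthogonal and commutes with the involutions, that
  is, it is a unitary equivalence between the complexifications of \<open>P\<close> and \<open>M\<close>, from which a real
  one is extracted.
\<close>

theorem williamson_factorization_unique:
  fixes H :: "'h::real_inner set" and K :: "'k::real_inner set" and H' :: "'m::real_inner set"
  assumes H: "real_hilbert_space H"
    and K: "real_hilbert_space K" "positive_op K P" "invertible_op K K P"
      "williamson_factorization H A K P L"
    and H': "real_hilbert_space H'" "strictly_positive_op H' M" "williamson_factorization H A H' M L'"
  shows "orthogonally_equivalent K P H' M"
proof -
  have M: "positive_op H' M" using H'(2) by (simp add: strictly_positive_op_def)
  note HH = real_hilbert_space_Times[OF H H] and KK = real_hilbert_space_Times[OF K(1) K(1)]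
    and HH' = real_hilbert_space_Times[OF H'(1) H'(1)]
  define p where "p = (\<lambda>k. P (hproj K k))"
  define m where "m = (\<lambda>k. M (hproj H' k))"
  have p: "hilbert_map K K p" "adjoint_maps p p" "\<And>x. 0 \<le> x \<bullet> p x"
    unfolding p_def by (rule positive_op_hproj[OF K(1,2)])+
  have m: "hilbert_map H' H' m" "adjoint_maps m m"
    unfolding m_def by (rule positive_op_hproj[OF H'(1) M])+
  have m_pos: "0 < y \<bullet> m y" if "y \<in> H'" "y \<noteq> 0" for y
    using H'(2) that by (simp add: m_def strictly_positive_op_def hproj_id[OF H'(1)])
  obtain p' where p'_map: "hilbert_map K K p'" and "\<And>x. p' (P (hproj K x)) = hproj K x"
    and p'_inv: "\<And>x. P (hproj K (p' x)) = hproj K x"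
    by (rule invertible_op_hproj[OF K(1) K(1) K(3)]) (rule that)
  have p': "hilbert_map K K p'" "\<And>x. p (p' x) = hproj K x"
    by (simp_all add: p_def p'_map p'_inv)
  obtain S1 T1 R1 where S1: "hilbert_map (H \<times> H) (K \<times> K) S1" "hilbert_map (K \<times> K) (H \<times> H) T1"
    "adjoint_maps S1 T1" "hilbert_map (K \<times> K) (H \<times> H) R1"
    "\<And>x. R1 (S1 x) = hproj (H \<times> H) x" "\<And>y. S1 (R1 y) = hproj (K \<times> K) y"
    "\<And>x. T1 (rot (S1 x)) = rot (hproj (H \<times> H) x)"
    "\<And>x. T1 (doubled p (S1 x)) = A (hproj (H \<times> H) x)"
    by (rule williamson_factorization_hproj[OF H K(1,2,4), folded p_def]) (rule that)
  obtain S2 T2 R2 where S2: "hilbert_map (H \<times> H) (H' \<times> H') S2" "hilbert_map (H' \<times> H') (H \<times> H) T2"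
    "adjoint_maps S2 T2" "hilbert_map (H' \<times> H') (H \<times> H) R2"
    "\<And>x. R2 (S2 x) = hproj (H \<times> H) x" "\<And>y. S2 (R2 y) = hproj (H' \<times> H') y"
    "\<And>x. T2 (rot (S2 x)) = rot (hproj (H \<times> H) x)"
    "\<And>x. T2 (doubled m (S2 x)) = A (hproj (H \<times> H) x)"
    by (rule williamson_factorization_hproj[OF H H'(1) M H'(3), folded m_def]) (rule that)
  obtain Q1 where Q1: "hilbert_map (H \<times> H) (K \<times> K) Q1" "adjoint_maps R1 Q1"
    using adjoint_exists[OF KK HH S1(4)] by blast
  have Q1T1: "Q1 (T1 y) = hproj (K \<times> K) y" for y
  proof (rule adjoint_maps_unique[of "\<lambda>x. S1 (R1 x)" "\<lambda>y. Q1 (T1 y)"])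
    show "adjoint_maps (\<lambda>x. S1 (R1 x)) (\<lambda>y. Q1 (T1 y))"
      by (rule adjoint_maps_compose[OF Q1(2) S1(3)])
    show "adjoint_maps (\<lambda>x. S1 (R1 x)) (hproj (K \<times> K))"
      by (simp add: S1(6) adjoint_maps_hproj[OF KK])
  qed
  define S where "S = (\<lambda>x. S2 (R1 x))"
  define T where "T = (\<lambda>y. Q1 (T2 y))"
  define R where "R = (\<lambda>y. S1 (R2 y))"
  have S: "hilbert_map (K \<times> K) (H' \<times> H') S" "adjoint_maps S T" "hilbert_map (H' \<times> H') (K \<times> K) T"
    unfolding S_def T_def
    by (rule hilbert_map_compose[OF S1(4) S2(1)] adjoint_maps_compose[OF Q1(2) S2(3)]
        hilbert_map_compose[OF S2(2) Q1(1)])+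
  have R: "hilbert_map (H' \<times> H') (K \<times> K) R"
    unfolding R_def by (rule hilbert_map_compose[OF S2(4) S1(1)])
  have SR: "S (R y) = hproj (H' \<times> H') y" for y
    by (simp add: S_def R_def S1(5) hproj_fixes[OF HH S2(4)] S2(6))
  have symp: "T (rot (S x)) = rot (hproj (K \<times> K) x)" for x
  proof -
    have "T (rot (S x)) = Q1 (T1 (rot (S1 (R1 x))))" by (simp add: T_def S_def S2(7) S1(7))
    then show ?thesis by (simp add: Q1T1 S1(6) hproj_rot[OF K(1)] hproj_hproj[OF KK])
  qed
  have cong: "T (doubled m (S x)) = doubled p x" for x
  proof -
    have "T (doubled m (S x)) = Q1 (T1 (doubled p (S1 (R1 x))))" by (simp add: T_def S_def S2(8) S1(8))
    then show ?thesis
      using hilbert_mapD(3)[OF hilbert_map_doubled[OF K(1) p(1)]]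
        hproj_fixes[OF KK hilbert_map_doubled[OF K(1) p(1)]]
      by (simp add: Q1T1 S1(6))
  qed
  note orth = symplectic_congruence_is_orthogonal[OF K(1) H'(1) p m(1,2) m_pos p' S R SR symp cong]
  obtain W V where W: "hilbert_map K H' W" "hilbert_map H' K V" "adjoint_maps W V"
    "\<And>x. V (W x) = hproj K x" "\<And>y. W (V y) = hproj H' y" "\<And>x. m (W x) = W (p x)"
    using unitary_equivalence_imp_orthogonal_equivalence[OF K(1) H'(1) p(1,2) m(1,2) S orth] by blast
  have sub: "subspace K" "subspace H'" using K(1) H'(1) by (simp_all add: real_hilbert_space_def)
  have tr: "transpose_op K H' (restrict W K) = restrict V H'"
    by (rule transpose_op_restrict[OF sub W(2,3)]) simp
  note mem = hilbert_mapD(2)[OF W(1)] hilbert_mapD(2)[OF W(2)]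
  have "orthogonal_transformation_op K H' (restrict W K)"
    unfolding orthogonal_transformation_op_def tr
    using bounded_op_restrict[OF W(1) sub(1)]
    by (auto simp: compose_def id_op_def fun_eq_iff restrict_def mem W(4,5) hproj_id K(1) H'(1))
  moreover have "compose H' (restrict W K) (compose H' P (transpose_op K H' (restrict W K))) = M"
  proof (rule extensionalityI[OF compose_extensional])
    show "M \<in> extensional H'" using M by (auto simp: positive_op_def bounded_op_def PiE_def)
    fix y assume y: "y \<in> H'"
    have P_p: "P (V y) = p (V y)" by (simp add: p_def hproj_id[OF K(1)] mem)
    have "W (p (V y)) = m (W (V y))" by (rule W(6)[symmetric])
    also have "\<dots> = M y" by (simp add: W(5) m_def hproj_id[OF H'(1)] y)
    finally show "compose H' (restrict W K) (compose H' P (transpose_op K H' (restrict W K))) y = M y"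
      using y by (simp add: compose_def tr P_p hilbert_mapD(2)[OF p(1)])
  qed
  ultimately show ?thesis unfolding orthogonally_equivalent_def by blast
qed

section \<open>Invariant real forms and inverses of square roots\<close>

lemma isotropic_span:
  fixes U :: "'a::real_inner \<Rightarrow> 'a"
  assumes U: "linear U" and B: "\<And>x y. x \<in> B \<Longrightarrow> y \<in> B \<Longrightarrow> x \<bullet> U y = 0"
    and x: "x \<in> span B" and y: "y \<in> span B"
  shows "x \<bullet> U y = 0"
proof -
  have 1: "x \<bullet> U y = 0" if "x \<in> B" for x
    using y
  proof (induction rule: span_induct)
    case base
    show ?case unfolding subspace_def mem_Collect_eq
      by (auto simp: linear_0[OF U] linear_add[OF U] linear_scale[OF U] inner_add)
  next
    case (step y)
    then show ?case by (simp add: B that)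
  qed
  show ?thesis
    using x
  proof (induction rule: span_induct)
    case base
    show ?case unfolding subspace_def by (auto simp: inner_add)
  next
    case (step x)
    then show ?case by (simp add: 1)
  qed
qed

lemma invariant_span:
  assumes R: "linear R" and B: "\<And>x. x \<in> B \<Longrightarrow> R x \<in> span B" and x: "x \<in> span B"
  shows "R x \<in> span B"
  using x
proof (induction rule: span_induct)
  case base
  show ?case unfolding subspace_def
    by (auto simp: linear_0[OF R] linear_add[OF R] linear_scale[OF R] span_zero span_add span_scale)
next
  case (step x)
  then show ?case by (simp add: B)
qed

text \<open>
  Here \<open>U\<close> plays the role of a complex structure that commutes with the symmetric operator \<open>R\<close>.
  By Zorn's lemma there is a maximal \<open>R\<close>-invariant subspace \<open>K\<close> that is isotropic, meaning
  \<open>K \<bottom> U K\<close>; its closure has the same properties, so \<open>K\<close> is closed.  If some \<open>v \<noteq> 0\<close> were orthogonal to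
  \<open>K\<close> and to \<open>U K\<close>, the cyclic subspace of \<open>v\<close> could be added to \<open>K\<close>: since \<open>U R\<^sup>n\<close> is
  skew-symmetric, \<open>R\<^sup>m v \<bullet> U (R\<^sup>n v) = v \<bullet> U (R\<^sup>m\<^sup>+\<^sup>n v) = 0\<close>.
\<close>

lemma invariant_real_form_exists:
  fixes R U :: "'a::real_inner \<Rightarrow> 'a"
  assumes G: "real_hilbert_space G" and R: "hilbert_map G G R" "adjoint_maps R R"
    and U: "hilbert_map G G U" "\<And>x y. U x \<bullet> y = - (x \<bullet> U y)"
    and UR: "\<And>x. U (R x) = R (U x)"
  obtains K where "real_hilbert_space K" "K \<subseteq> G" "\<And>x. x \<in> K \<Longrightarrow> R x \<in> K"
    "\<And>x y. x \<in> K \<Longrightarrow> y \<in> K \<Longrightarrow> x \<bullet> U y = 0"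
    "\<And>v. v \<in> G \<Longrightarrow> (\<And>h. h \<in> K \<Longrightarrow> v \<bullet> h = 0) \<Longrightarrow> (\<And>h. h \<in> K \<Longrightarrow> v \<bullet> U h = 0) \<Longrightarrow> v = 0"
proof -
  have subG: "subspace G" and comG: "complete G" using G by (auto simp: real_hilbert_space_def)
  have linU: "linear U" and linR: "linear R" by (rule hilbert_mapD(4)[OF U(1)] hilbert_mapD(4)[OF R(1)])+
  define \<A> where "\<A> = {K. subspace K \<and> K \<subseteq> G \<and> (\<forall>x\<in>K. R x \<in> K) \<and> (\<forall>x\<in>K. \<forall>y\<in>K. x \<bullet> U y = 0)}"
  have "{0} \<in> \<A>" using subspace_0[OF subG] by (simp add: \<A>_def hilbert_mapD(9)[OF R(1)])
  moreover have "\<Union>\<C> \<in> \<A>" if ne: "\<C> \<noteq> {}" and ch: "subset.chain \<A> \<C>" for \<C>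
  proof -
    have mem: "K \<in> \<A>" if "K \<in> \<C>" for K using ch that by (auto simp: subset.chain_def)
    have common: "\<exists>K\<in>\<C>. x \<in> K \<and> y \<in> K" if "x \<in> \<Union>\<C>" "y \<in> \<Union>\<C>" for x y
      using that ch unfolding subset.chain_def by blast
    have sub: "subspace K" if "K \<in> \<C>" for K using mem[OF that] by (simp add: \<A>_def)
    have "subspace (\<Union>\<C>)"
      unfolding subspace_def
    proof (intro conjI ballI allI)
      show "0 \<in> \<Union>\<C>" using ne sub subspace_0 by blast
      show "x + y \<in> \<Union>\<C>" if "x \<in> \<Union>\<C>" "y \<in> \<Union>\<C>" for x y
        using common[OF that] sub subspace_add by blast
      show "c *\<^sub>R x \<in> \<Union>\<C>" if "x \<in> \<Union>\<C>" for c x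
        using that sub subspace_scale by blast
    qed
    moreover have "x \<bullet> U y = 0" if "x \<in> \<Union>\<C>" "y \<in> \<Union>\<C>" for x y
      using common[OF that] mem unfolding \<A>_def by blast
    ultimately show ?thesis using mem unfolding \<A>_def by blast
  qed
  ultimately obtain K where K: "K \<in> \<A>" and max: "\<And>X. X \<in> \<A> \<Longrightarrow> K \<subseteq> X \<Longrightarrow> X = K"
    using subset_Zorn_nonempty[of \<A>] by blast
  have subK: "subspace K" and KG: "K \<subseteq> G" and RK: "\<And>x. x \<in> K \<Longrightarrow> R x \<in> K"
    and UK: "\<And>x y. x \<in> K \<Longrightarrow> y \<in> K \<Longrightarrow> x \<bullet> U y = 0"
    using K by (auto simp: \<A>_def)
  have clG: "closure K \<subseteq> G" using KG comG by (intro closure_minimal complete_imp_closed)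
  have "closure K \<in> \<A>"
  proof -
    have "R x \<in> closure K" if x: "x \<in> closure K" for x
    proof -
      obtain f where f: "\<And>n. f n \<in> K" "f \<longlonglongrightarrow> x" using x unfolding closure_sequential by blast
      show ?thesis
        by (rule limit_in_closure[OF bounded_linear.tendsto[OF hilbert_mapD(1)[OF R(1)] f(2)]])
          (rule RK[OF f(1)])
    qed
    moreover have "x \<bullet> U y = 0" if x: "x \<in> closure K" and y: "y \<in> closure K" for x y
    proof -
      obtain f where f: "\<And>n. f n \<in> K" "f \<longlonglongrightarrow> x" using x unfolding closure_sequential by blast
      obtain g where g: "\<And>n. g n \<in> K" "g \<longlonglongrightarrow> y" using y unfolding closure_sequential by blast
      have "(\<lambda>n. f n \<bullet> U (g n)) \<longlonglongrightarrow> x \<bullet> U y"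
        by (intro tendsto_inner f(2) bounded_linear.tendsto[OF hilbert_mapD(1)[OF U(1)] g(2)])
      then show ?thesis using UK[OF f(1) g(1)] by (simp add: LIMSEQ_const_iff)
    qed
    ultimately show ?thesis using subspace_closure[OF subK] clG by (simp add: \<A>_def)
  qed
  then have "closure K = K" by (rule max) (rule closure_subset)
  then have "closed K" by (metis closed_closure)
  then have hK: "real_hilbert_space K"
    using complete_closed_subset[OF _ KG comG] subK by (simp add: real_hilbert_space_def)
  have "v = 0" if v: "v \<in> G" "\<And>h. h \<in> K \<Longrightarrow> v \<bullet> h = 0" "\<And>h. h \<in> K \<Longrightarrow> v \<bullet> U h = 0" for v
  proof -
    define r where "r = (\<lambda>n. (R ^^ n) v)"
    have r0: "r 0 = v" and rS: "r (Suc n) = R (r n)" for n by (simp_all add: r_def)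
    have rG: "r n \<in> G" for n by (cases n) (simp_all add: r0 rS v(1) hilbert_mapD(2)[OF R(1)])
    have Rsym: "R x \<bullet> y = x \<bullet> R y" for x y by (rule adjoint_mapsD[OF R(2)])
    have r_K: "r n \<bullet> U h = 0" if "h \<in> K" for n h
      using that by (induction n arbitrary: h) (simp_all add: r0 rS v(3) Rsym UR[symmetric] RK)
    \<comment> \<open>This number equals its own negative, by symmetry of \<open>R\<close> and skewness of \<open>U\<close>.\<close>
    have v_r: "v \<bullet> U (r n) = 0" for n
    proof -
      have "r n \<bullet> U x = v \<bullet> U ((R ^^ n) x)" for x
        by (induction n arbitrary: x) (simp_all add: r0 rS Rsym UR[symmetric] funpow_swap1)
      from this[of v] have "r n \<bullet> U v = v \<bullet> U (r n)" by (simp add: r_def)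
      moreover have "r n \<bullet> U v = - (v \<bullet> U (r n))" using U(2)[of "r n" v] by (simp add: inner_commute)
      ultimately show ?thesis by simp
    qed
    have r_r: "r m \<bullet> U (r n) = 0" for m n
    proof (induction m arbitrary: n)
      case (Suc m)
      have "r (Suc m) \<bullet> U (r n) = r m \<bullet> U (r (Suc n))" by (simp add: rS Rsym UR)
      then show ?case by (simp add: Suc)
    qed (simp add: r0 v_r)
    define B where "B = K \<union> range r"
    have vB: "v \<in> span B" by (rule span_base) (auto simp: B_def r0 intro!: range_eqI[of _ _ 0])
    have KB: "K \<subseteq> span B" unfolding B_def by (meson Un_upper1 order_trans span_superset)
    have "span B \<in> \<A>"
      unfolding \<A>_def
    proof (intro CollectI conjI ballI)
      show "span B \<subseteq> G" using KG rG by (intro span_minimal subG) (auto simp: B_def)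
      show "R x \<in> span B" if "x \<in> span B" for x
        using that
        by (rule invariant_span[OF linR, rotated]) (auto simp: B_def RK rS[symmetric] intro!: span_base)
      show "x \<bullet> U y = 0" if "x \<in> span B" "y \<in> span B" for x y
      proof (rule isotropic_span[OF linU _ that])
        fix a b assume "a \<in> B" "b \<in> B"
        moreover have "h \<bullet> U (r n) = 0" if "h \<in> K" for h n
          using r_K[OF that, of n] U(2)[of h "r n"] by (simp add: inner_commute)
        ultimately show "a \<bullet> U b = 0" by (auto simp: B_def UK r_K r_r)
      qed
    qed (rule subspace_span)
    then have "span B = K" by (rule max) (rule KB)
    then have "v \<bullet> v = 0" using vB v(2) by simp
    then show "v = 0" by simp
  qed
  then show thesis using that[OF hK KG RK UK] by blast
qed

lemma inverse_commutes:
  assumes H: "real_hilbert_space H" and q: "hilbert_map H H q'"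
    and inv: "\<And>x. q (q' x) = hproj H x" "\<And>x. q' (q x) = hproj H x"
    and C: "hilbert_map H H C" "\<And>x. C (q x) = q (C x)"
  shows "C (q' x) = q' (C x)"
proof -
  have "C (q' x) = q' (q (C (q' x)))" by (simp add: inv hproj_fixes[OF H C(1)])
  also have "\<dots> = q' (C x)" by (simp add: C(2)[symmetric] inv hilbert_mapD(3)[OF C(1)])
  finally show ?thesis .
qed

lemma inverse_symmetric:
  assumes H: "real_hilbert_space H" and q: "hilbert_map H H q'" "adjoint_maps q q"
    and inv: "\<And>x. q (q' x) = hproj H x"
  shows "adjoint_maps q' q'"
  unfolding adjoint_maps_def
proof (intro allI)
  fix x y
  have "q' x \<bullet> y = q' x \<bullet> q (q' y)"
    by (simp add: inv hproj_sym[OF H, symmetric] hproj_fixes[OF H q(1)])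
  also have "\<dots> = q (q' x) \<bullet> q' y" by (rule adjoint_mapsD[OF q(2), symmetric])
  also have "\<dots> = hproj H x \<bullet> q' y" by (simp only: inv)
  also have "\<dots> = x \<bullet> q' y" by (rule hproj_inner[OF H hilbert_mapD(2)[OF q(1)]])
  finally show "q' x \<bullet> y = x \<bullet> q' y" .
qed

lemma positive_invertible_square_root:
  fixes T :: "'a::real_inner \<Rightarrow> 'a"
  assumes H: "real_hilbert_space H" and T: "hilbert_map H H T" "adjoint_maps T T"
    and pos: "\<And>x. 0 \<le> x \<bullet> T x"
    and T': "hilbert_map H H T'" "\<And>x. T (T' x) = hproj H x" "\<And>x. T' (T x) = hproj H x"
  obtains R R' where "hilbert_map H H R" "adjoint_maps R R" "\<And>x. 0 \<le> x \<bullet> R x"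
    "\<And>x. R (R x) = T x"
    "\<And>C x. hilbert_map H H C \<Longrightarrow> (\<And>x. C (T x) = T (C x)) \<Longrightarrow> C (R x) = R (C x)"
    "hilbert_map H H R'" "adjoint_maps R' R'"
    "\<And>x. R (R' x) = hproj H x" "\<And>x. R' (R x) = hproj H x"
    "\<And>C x. hilbert_map H H C \<Longrightarrow> (\<And>x. C (T x) = T (C x)) \<Longrightarrow> C (R' x) = R' (C x)"
proof -
  obtain R where R: "hilbert_map H H R" "adjoint_maps R R" "\<And>x. 0 \<le> x \<bullet> R x"
    "\<And>x. R (R x) = T x"
    "\<And>C x. hilbert_map H H C \<Longrightarrow> (\<And>x. C (T x) = T (C x)) \<Longrightarrow> C (R x) = R (C x)"
    using positive_square_root[OF H T pos] by blast
  define R' where "R' = (\<lambda>x. R (T' x))"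
  have R': "hilbert_map H H R'" unfolding R'_def by (rule hilbert_map_compose[OF T'(1) R(1)])
  have RR': "R (R' x) = hproj H x" for x by (simp add: R'_def R(4) T'(2))
  have "R (T x) = T (R x)" for x by (simp flip: R(4))
  then have "R (T' x) = T' (R x)" for x by (rule inverse_commutes[OF H T'(1,2,3) R(1)])
  then have R'R: "R' (R x) = hproj H x" for x
    by (simp add: R'_def flip: R(4)) (simp add: R(4) T'(3))
  show thesis
    by (rule that[OF R R' inverse_symmetric[OF H R' R(2) RR'] RR' R'R])
      (assumption | rule inverse_commutes[OF H R' RR' R'R] R(5))+
qed

section \<open>Existence of the factorization\<close>

lemma rot_skew: "rot u \<bullet> v = - (u \<bullet> rot v)"
  by (simp add: inner_prod_def)

lemma bounded_linear_rot: "bounded_linear rot"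
  unfolding rot_def[abs_def]
  by (intro bounded_linear_Pair bounded_linear_minus bounded_linear_fst bounded_linear_snd)

lemma hilbert_map_rot:
  assumes "real_hilbert_space H" "hilbert_map G (H \<times> H) f"
  shows "hilbert_map G (H \<times> H) (\<lambda>x. rot (f x))"
proof -
  have "subspace H" using assms(1) by (simp add: real_hilbert_space_def)
  then show ?thesis
    using assms(2) bounded_linear_compose[OF bounded_linear_rot]
    by (auto simp: hilbert_map_def mem_Times_iff subspace_neg)
qed

text \<open>
  For an invertible skew-symmetric \<open>B\<close> the operator \<open>B\<^sup>T B = - B\<^sup>2\<close> is positive.  Its square root
  \<open>R\<close> commutes with \<open>B\<close>, so \<open>U = B R\<inverse>\<close> is skew-symmetric with \<open>U\<^sup>2 = - I\<close>.
\<close>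

lemma skew_polar_decomposition:
  fixes B :: "'a::real_inner \<Rightarrow> 'a"
  assumes G: "real_hilbert_space G"
    and B: "hilbert_map G G B" "\<And>x y. B x \<bullet> y = - (x \<bullet> B y)"
    and B': "hilbert_map G G B'" "\<And>x. B (B' x) = hproj G x" "\<And>x. B' (B x) = hproj G x"
  obtains R R' U where "hilbert_map G G R" "adjoint_maps R R" "\<And>x. 0 \<le> x \<bullet> R x"
    "hilbert_map G G R'" "\<And>x. R (R' x) = hproj G x" "\<And>x. R' (R x) = hproj G x"
    "hilbert_map G G U" "\<And>x y. U x \<bullet> y = - (x \<bullet> U y)" "\<And>x. U (U x) = - hproj G x"
    "\<And>x. U (R x) = R (U x)" "\<And>x. U (R' x) = - B' x"
proof -
  define T where "T = (\<lambda>x. - B (B x))"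
  define T' where "T' = (\<lambda>x. - B' (B' x))"
  note Blin = hilbert_mapD[OF B(1)] and B'lin = hilbert_mapD[OF B'(1)]
  have T: "hilbert_map G G T" unfolding T_def
    by (rule hilbert_map_minus[OF G hilbert_map_compose[OF B(1) B(1)]])
  have T': "hilbert_map G G T'" unfolding T'_def
    by (rule hilbert_map_minus[OF G hilbert_map_compose[OF B'(1) B'(1)]])
  have Tsym: "adjoint_maps T T" by (simp add: adjoint_maps_def T_def B(2))
  have pos: "0 \<le> x \<bullet> T x" for x using B(2)[of x "B x"] by (simp add: T_def) (metis inner_ge_zero neg_0_le_iff_le minus_minus)
  have TT': "T (T' x) = hproj G x" "T' (T x) = hproj G x" for x
    by (simp_all add: T_def T'_def Blin B'lin B'(2,3) hproj_fixes[OF G B'(1)] hproj_fixes[OF G B(1)])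
  obtain R R' where R: "hilbert_map G G R" "adjoint_maps R R" "\<And>x. 0 \<le> x \<bullet> R x"
    "\<And>x. R (R x) = T x"
    "\<And>C x. hilbert_map G G C \<Longrightarrow> (\<And>x. C (T x) = T (C x)) \<Longrightarrow> C (R x) = R (C x)"
    "hilbert_map G G R'" "adjoint_maps R' R'"
    "\<And>x. R (R' x) = hproj G x" "\<And>x. R' (R x) = hproj G x"
    "\<And>C x. hilbert_map G G C \<Longrightarrow> (\<And>x. C (T x) = T (C x)) \<Longrightarrow> C (R' x) = R' (C x)"
    using positive_invertible_square_root[OF G T Tsym pos T' TT'] by blast
  have BR: "B (R x) = R (B x)" and BR': "B (R' x) = R' (B x)" for x
    by (rule R(5)[OF B(1)] R(10)[OF B(1)]; simp add: T_def Blin)+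
  define U where "U = (\<lambda>x. B (R' x))"
  have U: "hilbert_map G G U" unfolding U_def by (rule hilbert_map_compose[OF R(6) B(1)])
  have BB: "B (B x) = - R (R x)" for x by (simp add: R(4) T_def)
  show thesis
  proof (rule that[OF R(1-3,6,8,9) U])
    show "U x \<bullet> y = - (x \<bullet> U y)" for x y
      by (simp add: U_def B(2) BR' adjoint_mapsD[OF R(7)])
    have "B (R' (B (R' x))) = B (B (R' (R' x)))" for x by (simp add: BR')
    then show "U (U x) = - hproj G x" for x
      by (simp add: U_def BB R(8) hproj_fixes[OF G R(6)])
    show "U (R x) = R (U x)" for x
      by (simp add: U_def R(8,9) Blin flip: BR)
    have "B (U (R' x)) = B (B' (- x))" for x
      by (simp add: U_def BB R(8) hproj_fixes[OF G R(6)] B'(2) hproj_minus[OF G])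
    then have "B' (B (U (R' x))) = B' (B (B' (- x)))" for x by simp
    then show "U (R' x) = - B' x" for x
      by (simp add: B'(3) hproj_fixes[OF G U] hproj_fixes[OF G B'(1)] B'lin hproj_minus[OF G])
  qed
qed

text \<open>
  If \<open>K \<oplus> U K\<close> is dense, every vector is the sum of its projections to \<open>K\<close> and to \<open>U K\<close>; the
  projection to \<open>U K\<close> is the conjugate \<open>- U (hproj K) U\<close> of the projection to \<open>K\<close>.
\<close>

lemma real_form_decomposition:
  fixes U :: "'a::real_inner \<Rightarrow> 'a"
  assumes G: "real_hilbert_space G"
    and U: "hilbert_map G G U" "\<And>x y. U x \<bullet> y = - (x \<bullet> U y)" "\<And>x. U (U x) = - hproj G x"
    and K: "real_hilbert_space K" "K \<subseteq> G" "\<And>x y. x \<in> K \<Longrightarrow> y \<in> K \<Longrightarrow> x \<bullet> U y = 0"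
    and total: "\<And>v. v \<in> G \<Longrightarrow> (\<And>h. h \<in> K \<Longrightarrow> v \<bullet> h = 0) \<Longrightarrow> (\<And>h. h \<in> K \<Longrightarrow> v \<bullet> U h = 0) \<Longrightarrow> v = 0"
    and w: "w \<in> G"
  shows "w = hproj K w - U (hproj K (U w))"
proof -
  have subG: "subspace G" using G by (simp add: real_hilbert_space_def)
  define k where "k = hproj K"
  have kK: "k x \<in> K" for x by (simp add: k_def hproj_in[OF K(1)])
  have kh: "k x \<bullet> h = x \<bullet> h" if "h \<in> K" for x h using that by (simp add: k_def hproj_inner[OF K(1)])
  have UU: "U x \<bullet> U h = x \<bullet> h" if "h \<in> K" for x h
    using that K(2) by (auto simp: U(2,3) hproj_id[OF G])
  have "w - (k w - U (k (U w))) = 0"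
  proof (rule total)
    show "w - (k w - U (k (U w))) \<in> G"
      using w kK K(2) hilbert_mapD(2)[OF U(1)] by (intro subspace_diff subG) auto
    fix h assume h: "h \<in> K"
    show "(w - (k w - U (k (U w)))) \<bullet> h = 0"
      by (simp add: inner_diff kh h U(2) K(3) kK)
    have "(w - (k w - U (k (U w)))) \<bullet> U h = w \<bullet> U h + k (U w) \<bullet> h"
      by (simp add: inner_diff UU h K(3) kK)
    then show "(w - (k w - U (k (U w)))) \<bullet> U h = 0"
      by (simp add: kh h U(2))
  qed
  then show ?thesis by (simp add: k_def)
qed

text \<open>
  Let \<open>q\<close> be the square root of \<open>A\<close>, let \<open>B = q J q\<close> have polar decomposition \<open>B = U R\<close>, and let
  \<open>K\<close> be an \<open>R\<close>-invariant real form of \<open>U\<close>.  Writing \<open>w = x + U y\<close> with \<open>x, y \<in> K\<close> identifies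
  \<open>w\<close> with \<open>(x, y)\<close>; this orthogonal map \<open>\<Gamma>\<close> turns \<open>U\<close> into the involution and \<open>R\<close> into \<open>P \<oplus> P\<close>
  with \<open>P\<close> the restriction of \<open>R\<close>.  With \<open>F = R\<^sup>-\<^sup>1\<^sup>/\<^sup>2 q\<close> the map \<open>L = \<Gamma> F\<close> satisfies
  \<open>L\<^sup>T (P \<oplus> P) L = F\<^sup>T R F = q q = A\<close> and
  \<open>L\<^sup>T J L = F\<^sup>T U F = q U R\<inverse> q = - q B\<inverse> q = J\<close>.
\<close>

theorem williamson_factorization_exists:
  fixes H :: "'h::real_inner set" and A :: "'h \<times> 'h \<Rightarrow> 'h \<times> 'h"
  assumes H: "real_hilbert_space H"
    and A: "positive_op (H \<times> H) A" "invertible_op (H \<times> H) (H \<times> H) A"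
  shows "\<exists>(K :: ('h \<times> 'h) set) P L.
      real_hilbert_space K \<and> positive_op K P \<and> invertible_op K K P \<and>
      williamson_factorization H A K P L"
proof -
  define G where "G = H \<times> H"
  have G: "real_hilbert_space G" unfolding G_def by (rule real_hilbert_space_Times[OF H H])
  define g where "g = hproj G"
  note g_id = hproj_id[OF G, folded g_def] and g_fix = hproj_fixes[OF G, folded g_def]
    and g_pre = hilbert_mapD(3)[where H = G, folded g_def]
  have g_rot: "g (rot x) = rot (g x)" for x unfolding g_def G_def by (rule hproj_rot[OF H])
  define a where "a = (\<lambda>x. A (hproj G x))"
  have a: "hilbert_map G G a" "adjoint_maps a a" "\<And>x. 0 \<le> x \<bullet> a x"
    unfolding a_def using A(1) by (intro positive_op_hproj[OF G]; simp add: G_def)+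
  obtain a' where a'_map: "hilbert_map G G a'"
    and a'_inv: "\<And>x. a' (A (hproj G x)) = hproj G x" "\<And>x. A (hproj G (a' x)) = hproj G x"
    by (rule invertible_op_hproj[OF G G A(2)[folded G_def]]) (rule that)
  have a': "hilbert_map G G a'" "\<And>x. a' (a x) = g x" "\<And>x. a (a' x) = g x"
    by (simp_all add: a_def g_def a'_map a'_inv)
  obtain q q' where q: "hilbert_map G G q" "adjoint_maps q q" "\<And>x. 0 \<le> x \<bullet> q x"
    "\<And>x. q (q x) = a x"
    "\<And>C x. hilbert_map G G C \<Longrightarrow> (\<And>x. C (a x) = a (C x)) \<Longrightarrow> C (q x) = q (C x)"
    "hilbert_map G G q'" "adjoint_maps q' q'"
    "\<And>x. q (q' x) = g x" "\<And>x. q' (q x) = g x"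
    "\<And>C x. hilbert_map G G C \<Longrightarrow> (\<And>x. C (a x) = a (C x)) \<Longrightarrow> C (q' x) = q' (C x)"
    using positive_invertible_square_root[OF G a a'(1) a'(3)[unfolded g_def] a'(2)[unfolded g_def]]
    unfolding g_def by blast
  have rot_q: "hilbert_map G G (\<lambda>x. rot (q x))" "hilbert_map G G (\<lambda>x. rot (q' x))"
    using hilbert_map_rot[OF H] q(1,6) unfolding G_def by blast+
  \<comment> \<open>\<open>B = q J q\<close>, with inverse \<open>- q\<inverse> J q\<inverse>\<close> because \<open>J\<inverse> = - J\<close>.\<close>
  define B where "B = (\<lambda>x. q (rot (q x)))"
  define B' where "B' = (\<lambda>x. - q' (rot (q' x)))"
  have B: "hilbert_map G G B" unfolding B_def by (rule hilbert_map_compose[OF rot_q(1) q(1)])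
  have B': "hilbert_map G G B'" unfolding B'_def
    by (rule hilbert_map_minus[OF G hilbert_map_compose[OF rot_q(2) q(6)]])
  have Bskew: "B x \<bullet> y = - (x \<bullet> B y)" for x y
    by (simp add: B_def adjoint_mapsD[OF q(2)] rot_skew)
  have BB': "B (B' x) = g x" for x
    by (simp add: B_def B'_def hilbert_mapD[OF q(1)] q(8) g_rot g_fix[OF q(6)])
  have B'B: "B' (B x) = g x" for x
    by (simp add: B_def B'_def hilbert_mapD[OF q(6)] q(9) g_rot g_fix[OF q(1)])
  obtain R R' U where R: "hilbert_map G G R" "adjoint_maps R R" "\<And>x. 0 \<le> x \<bullet> R x"
    and R': "hilbert_map G G R'" "\<And>x. R (R' x) = g x" "\<And>x. R' (R x) = g x"
    and U: "hilbert_map G G U" "\<And>x y. U x \<bullet> y = - (x \<bullet> U y)" "\<And>x. U (U x) = - g x"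
    and UR: "\<And>x. U (R x) = R (U x)" and UR': "\<And>x. U (R' x) = - B' x"
    using skew_polar_decomposition[OF G B Bskew B' BB'[unfolded g_def] B'B[unfolded g_def]]
    unfolding g_def by blast
  \<comment> \<open>The square root of \<open>R\<close> supplies the factor \<open>R\<^sup>-\<^sup>1\<^sup>/\<^sup>2\<close> in \<open>F\<close>.\<close>
  obtain s s' where s: "hilbert_map G G s" "adjoint_maps s s" "\<And>x. 0 \<le> x \<bullet> s x"
    "\<And>x. s (s x) = R x"
    "\<And>C x. hilbert_map G G C \<Longrightarrow> (\<And>x. C (R x) = R (C x)) \<Longrightarrow> C (s x) = s (C x)"
    "hilbert_map G G s'" "adjoint_maps s' s'"
    "\<And>x. s (s' x) = g x" "\<And>x. s' (s x) = g x"
    "\<And>C x. hilbert_map G G C \<Longrightarrow> (\<And>x. C (R x) = R (C x)) \<Longrightarrow> C (s' x) = s' (C x)"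
    using positive_invertible_square_root[OF G R R'(1) R'(2)[unfolded g_def] R'(3)[unfolded g_def]]
    unfolding g_def by blast
  have Us': "U (s' x) = s' (U x)" for x by (rule s(10)[OF U(1) UR])
  obtain K where K: "real_hilbert_space K" "K \<subseteq> G" "\<And>x. x \<in> K \<Longrightarrow> R x \<in> K"
    "\<And>x y. x \<in> K \<Longrightarrow> y \<in> K \<Longrightarrow> x \<bullet> U y = 0"
    "\<And>v. v \<in> G \<Longrightarrow> (\<And>h. h \<in> K \<Longrightarrow> v \<bullet> h = 0) \<Longrightarrow> (\<And>h. h \<in> K \<Longrightarrow> v \<bullet> U h = 0) \<Longrightarrow> v = 0"
    using invariant_real_form_exists[OF G R(1,2) U(1,2) UR] by blast
  have subK: "subspace K" using K(1) by (simp add: real_hilbert_space_def)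
  define k where "k = hproj K"
  note klin = hilbert_mapD[OF hilbert_map_hproj[OF K(1)], folded k_def]
  note Ulin = hilbert_mapD[OF U(1)] and Rlin = hilbert_mapD[OF R(1)]
  have kK: "k x \<in> K" for x by (rule klin(2))
  have k_id: "k x = x" if "x \<in> K" for x using that by (simp add: k_def hproj_id[OF K(1)])
  have kG: "k x \<in> G" for x using kK K(2) by blast
  have gk: "g (k x) = k x" for x by (rule g_id[OF kG])
  have kg: "k (g x) = k x" for x
    unfolding k_def
  proof (rule hproj_eqI[OF K(1)])
    show "hproj K x \<in> K" by (rule hproj_in[OF K(1)])
    fix h assume "h \<in> K"
    then show "(g x - hproj K x) \<bullet> h = 0"
      using K(2) by (auto simp: inner_diff g_def hproj_inner[OF G] hproj_inner[OF K(1)])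
  qed
  have k_map: "hilbert_map G G k"
    using kg kG klin(1) by (simp add: hilbert_map_def g_def)
  have kR: "k (R x) = R (k x)" for x
    unfolding k_def
  proof (rule hproj_eqI[OF K(1)])
    show "R (hproj K x) \<in> K" by (intro K(3) hproj_in[OF K(1)])
    fix h assume "h \<in> K"
    then show "(R x - R (hproj K x)) \<bullet> h = 0"
      by (simp add: inner_diff adjoint_mapsD[OF R(2)] hproj_inner[OF K(1)] K(3))
  qed
  have kR': "k (R' x) = R' (k x)" for x
    by (rule inverse_commutes[OF G R'(1) R'(2,3)[unfolded g_def] k_map kR])
  have kUk: "k (U (k x)) = 0" for x
    unfolding k_def
  proof (rule hproj_eqI[OF K(1)])
    show "0 \<in> K" by (rule subspace_0[OF subK])
    fix h assume "h \<in> K"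
    then show "(U (hproj K x) - 0) \<bullet> h = 0" by (simp add: U(2) K(4) hproj_in[OF K(1)])
  qed
  have decomp: "k w - U (k (U w)) = w" if "w \<in> G" for w
    unfolding k_def
    by (rule real_form_decomposition[OF G U(1,2) U(3)[unfolded g_def] K(1,2,4,5) that, symmetric])
  have U_decomp: "k (U w) + U (k w) = U w" if "w \<in> G" for w
  proof -
    have "U w = U (k w - U (k (U w)))" by (simp add: decomp[OF that])
    then show ?thesis by (simp add: Ulin U(3) gk add.commute)
  qed
  \<comment> \<open>\<open>\<Gamma>'\<close> sends \<open>(x, y)\<close> to \<open>x + U y\<close>; it is both the adjoint and the inverse of \<open>\<Gamma>\<close>.\<close>
  define \<Gamma> where "\<Gamma> = (\<lambda>w. (k w, - k (U w)))"
  define \<Gamma>' where "\<Gamma>' = (\<lambda>v. k (fst v) + U (k (snd v)))"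
  have \<Gamma>: "hilbert_map G (K \<times> K) \<Gamma>"
  proof -
    have "bounded_linear \<Gamma>" unfolding \<Gamma>_def
      by (intro bounded_linear_Pair bounded_linear_minus bounded_linear_compose[OF klin(1) Ulin(1)] klin(1))
    then show ?thesis
      using kg g_pre[OF U(1)] subspace_neg[OF subK] kK by (simp add: hilbert_map_def \<Gamma>_def g_def)
  qed
  have \<Gamma>': "hilbert_map (K \<times> K) G \<Gamma>'"
  proof -
    have "bounded_linear \<Gamma>'" unfolding \<Gamma>'_def
      by (intro bounded_linear_add bounded_linear_compose[OF klin(1)] bounded_linear_fst
          bounded_linear_compose[OF Ulin(1)] bounded_linear_snd)
    moreover have "\<Gamma>' v \<in> G" for v
      using G kG Ulin(2) by (simp add: \<Gamma>'_def real_hilbert_space_def subspace_add)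
    ultimately show ?thesis
      by (simp add: hilbert_map_def \<Gamma>'_def hproj_Times K(1) flip: k_def) (simp add: k_def hproj_hproj K(1))
  qed
  have \<Gamma>\<Gamma>': "adjoint_maps \<Gamma> \<Gamma>'"
  proof -
    have ksym: "k u \<bullet> v = u \<bullet> k v" for u v by (simp add: k_def hproj_sym[OF K(1)])
    have "\<Gamma> w \<bullet> (x, y) = w \<bullet> \<Gamma>' (x, y)" for w x y
      by (simp only: \<Gamma>_def \<Gamma>'_def inner_Pair fst_conv snd_conv inner_add_right inner_minus_left
          ksym U(2) minus_minus)
    then show ?thesis by (auto simp: adjoint_maps_def)
  qed
  have \<Gamma>'\<Gamma>: "\<Gamma>' (\<Gamma> w) = w" if "w \<in> G" for w
    using decomp[OF that] by (simp add: \<Gamma>_def \<Gamma>'_def klin Ulin k_id kK)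
  have \<Gamma>\<Gamma>'_id: "\<Gamma> (\<Gamma>' v) = v" if "v \<in> K \<times> K" for v
    using that by (auto simp: \<Gamma>_def \<Gamma>'_def klin Ulin kUk U(3) gk k_id kK)
  define F where "F = (\<lambda>x. s' (q x))"
  define F' where "F' = (\<lambda>x. q' (s x))"
  define Ft where "Ft = (\<lambda>x. q (s' x))"
  have F: "hilbert_map G G F" "hilbert_map G G F'" "hilbert_map G G Ft" "adjoint_maps F Ft"
    unfolding F_def F'_def Ft_def
    by (rule hilbert_map_compose[OF q(1) s(6)] hilbert_map_compose[OF s(1) q(6)]
        hilbert_map_compose[OF s(6) q(1)] adjoint_maps_compose[OF q(2) s(7)])+
  have FG: "F x \<in> G" for x by (rule hilbert_mapD(2)[OF F(1)])
  have FF': "F (F' x) = x" "F' (F x) = x" if "x \<in> G" for x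
    using that by (simp_all add: F_def F'_def q(8,9) s(8,9) g_fix[OF s(1)] g_fix[OF q(1)] g_id)
  define S where "S = (\<lambda>x. \<Gamma> (F x))"
  define S' where "S' = (\<lambda>v. F' (\<Gamma>' v))"
  define St where "St = (\<lambda>v. Ft (\<Gamma>' v))"
  have S: "hilbert_map G (K \<times> K) S" "hilbert_map (K \<times> K) G St" "adjoint_maps S St"
    "hilbert_map (K \<times> K) G S'"
    unfolding S_def St_def S'_def
    by (rule hilbert_map_compose[OF F(1) \<Gamma>] hilbert_map_compose[OF \<Gamma>' F(3)]
        adjoint_maps_compose[OF F(4) \<Gamma>\<Gamma>'] hilbert_map_compose[OF \<Gamma>' F(2)])+
  have S'S: "S' (S x) = x" if "x \<in> G" for x
    by (simp add: S_def S'_def \<Gamma>'\<Gamma>[OF FG] FF'[OF that])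
  have SS': "S (S' v) = v" if "v \<in> K \<times> K" for v
    by (simp add: S_def S'_def FF'(1)[OF hilbert_mapD(2)[OF \<Gamma>']] \<Gamma>\<Gamma>'_id[OF that])
  have s's': "s' (s' x) = R' x" for x
  proof -
    have "s' (s' x) = s' (s' (R (R' x)))" by (simp add: R'(2) g_pre[OF s(6)])
    also have "\<dots> = R' x" by (simp add: s(9) g_fix[OF s(1)] g_fix[OF R'(1)] flip: s(4))
    finally show ?thesis .
  qed
  have symp: "St (rot (S x)) = rot x" if x: "x \<in> G" for x
  proof -
    have "\<Gamma>' (rot (\<Gamma> w)) = U w" if "w \<in> G" for w
      using U_decomp[OF that] by (simp add: \<Gamma>_def \<Gamma>'_def klin k_id kK)
    then have "St (rot (S x)) = q (s' (U (s' (q x))))"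
      by (simp add: St_def S_def FG Ft_def) (simp add: F_def)
    also have "\<dots> = q (U (R' (q x)))" by (simp add: s's' flip: Us')
    also have "\<dots> = g (rot (g x))"
      by (simp add: UR' B'_def q(8,9))
    also have "\<dots> = rot x" by (simp add: g_rot g_id x)
    finally show ?thesis .
  qed
  define P where "P = (\<lambda>x. R (k x))"
  have P: "hilbert_map K K P"
    unfolding hilbert_map_def P_def
    using bounded_linear_compose[OF Rlin(1) klin(1)] K(3)[OF kK] klin(3) by (simp add: k_def)
  have Psym: "adjoint_maps P P"
  proof -
    have "R (k x) \<bullet> y = x \<bullet> R (k y)" for x y
    proof -
      have "R (k x) \<bullet> y = k x \<bullet> R y" by (rule adjoint_mapsD[OF R(2)])
      also have "\<dots> = x \<bullet> k (R y)" unfolding k_def by (rule hproj_sym[OF K(1)])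
      finally show ?thesis by (simp only: kR)
    qed
    then show ?thesis by (simp add: adjoint_maps_def P_def)
  qed
  have Ppos: "0 \<le> x \<bullet> P x" for x
  proof -
    have "x \<bullet> P x = k x \<bullet> R (k x)"
      by (simp add: P_def k_def hproj_inner[OF K(1) K(3)] hproj_in[OF K(1)])
    then show ?thesis using R(3) by simp
  qed
  define P' where "P' = (\<lambda>x. R' (k x))"
  have P': "hilbert_map K K P'"
  proof -
    have "R' (k x) \<in> K" for x by (metis kK kR')
    then show ?thesis
      unfolding hilbert_map_def P'_def
      using bounded_linear_compose[OF hilbert_mapD(1)[OF R'(1)] klin(1)] klin(3) by (simp add: k_def)
  qed
  have Pinv: "P' (P x) = x" "P (P' x) = x" if "x \<in> K" for x
  proof -
    have gx: "g x = x" using gk[of x] by (simp add: k_id that)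
    then show "P' (P x) = x" "P (P' x) = x"
      by (simp_all add: P_def P'_def kR kR' k_id kK R'(2,3) that)
  qed
  have A_fac: "St (doubled P (S x)) = A x" if x: "x \<in> G" for x
  proof -
    have "\<Gamma>' (doubled P (\<Gamma> w)) = R w" if "w \<in> G" for w
    proof -
      have "\<Gamma>' (doubled P (\<Gamma> w)) = R (k w) - U (R (k (U w)))"
        by (simp add: \<Gamma>_def \<Gamma>'_def doubled_def P_def klin Rlin Ulin kR k_id kK)
      also have "\<dots> = R (k w - U (k (U w)))" by (simp add: UR Rlin)
      also have "\<dots> = R w" by (simp add: decomp[OF that])
      finally show ?thesis .
    qed
    then have "St (doubled P (S x)) = q (s' (R (s' (q x))))"
      by (simp add: St_def S_def FG Ft_def) (simp add: F_def)
    also have "\<dots> = q (g (g (q x)))" by (simp add: s(8,9) g_fix[OF s(1)] flip: s(4))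
    also have "\<dots> = A x" by (simp add: g_fix[OF q(1)] q(4) a_def hproj_id[OF G x])
    finally show ?thesis .
  qed
  have A_ext: "A \<in> extensional (H \<times> H)"
    using A(1) by (auto simp: positive_op_def bounded_op_def PiE_def)
  have "williamson_factorization H A K (restrict P K) (restrict S (H \<times> H))"
    by (rule williamson_factorization_restrict[OF H K(1) P S[unfolded G_def]
          S'S[unfolded G_def] SS' symp[unfolded G_def] A_ext A_fac[unfolded G_def]])
  then show ?thesis
    using K(1) positive_op_restrict[OF K(1) P Psym Ppos] invertible_op_restrict[OF K(1) K(1) P P' Pinv]
    by blast
qed

theorem theorem4p3:
  fixes H :: "'h::real_inner set" and A :: "'h \<times> 'h \<Rightarrow> 'h \<times> 'h"
  assumes "real_hilbert_space H"
    and "strictly_positive_op (H \<times> H) A"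
    and "invertible_op (H \<times> H) (H \<times> H) A"
  shows
    "(\<exists>(K :: ('h \<times> 'h) set) P L.
        real_hilbert_space K \<and> positive_op K P \<and> invertible_op K K P \<and>
        williamson_factorization H A K P L)
     \<and>
     (\<forall>(K :: 'k::real_inner set) P L (H' :: 'm::real_inner set) M L'.
        real_hilbert_space K \<and> positive_op K P \<and> invertible_op K K P \<and>
        williamson_factorization H A K P L \<and>
        real_hilbert_space H' \<and> strictly_positive_op H' M \<and> invertible_op H' H' M \<and>
        williamson_factorization H A H' M L'
        \<longrightarrow> orthogonally_equivalent K P H' M)"
proof (intro conjI allI impI)
  show "\<exists>(K :: ('h \<times> 'h) set) P L.
        real_hilbert_space K \<and> positive_op K P \<and> invertible_op K K P \<and>
        williamson_factorization H A K P L"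
    using assms by (intro williamson_factorization_exists) (simp_all add: strictly_positive_op_def)
qed (use williamson_factorization_unique[OF assms(1)] in blast)

end
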